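(* Let $(T(t))_{t\ge0}$ be a $C_0$-semigroup on a Banach space $X$ with generator $A$, and let $K:[0,\infty)\times X\to X$ be collectively compact and continuous separately in both variables. Let $X_0\subset X$, $y\in X$, $r>0$ with $B:=\overline{B}(y,r)\subset X_0$. Assume that for every $x_0\in B$ there exists a solution $x=x(\cdot,x_0)\in C([0,\infty),X)$ of $$x(t,x_0)=T(t)x_0+\int_0^tT(t-s)K(s,x(s,x_0))\,ds,\qquad t\ge0,\qquad( * )$$ such that the set $\{x(t,x_0):\ 0\le t\le\tau,\ x_0\in B\}$ is bounded for each $\tau>0$. Set $\alpha=\limsup_{t\to0}\|T(t)\|$, let $a:[0,\infty)\to[0,\infty)$ be a non-increasing function satisfying $\lim_{t\to\infty}a(t)=0$, and let $t_0\ge0$ with $a(t_0)<\frac{r}{2\alpha}$. Assume that $\omega\in\mathbb R$ is admissible. Then there exist $z\in\overline{B}(y,r)$ and a solution $x(\cdot,z)$ of $( * )$ with $x_0=z$ such that $$\|x(t,z)\|\ge a(t)e^{\omega t},\qquad t\ge t_0.$$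
   Context: All Banach spaces are complex and infinite-dimensional. $\overline{B}(y,r)$ is the closed ball with center $y$ and radius $r$. $K$ is collectively compact if $K([0,t_0]\times B)$ is precompact in $X$ for each bounded set $B\subset X$ and each $t_0\ge0$. Solutions of $( * )$ are not assumed to be unique. A number $\omega\in\mathbb R$ is called admissible (for $(T(t))_{t\ge0}$) if for every $t_0>0$, every $\varepsilon>0$ and every subspace $M\subset X$ of the form $M=\bigcap_{1\le j\le n}\operatorname{Ker}y_j^*$ with $y_j^*\in D(A^* )$ for $j\in\{1,\dots,n\}$, there exist $x\in M$ with $\|x\|=1$ and $\mu\in\mathbb C$ with $\operatorname{Re}\mu=\omega$ such that $\|T(t)x-e^{\mu t}x\|<\varepsilon$ for $0\le t\le t_0$. *)

theory Defs
  imports "HOL-Analysis.Analysis"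
begin

section \<open>Complex Banach spaces\<close>

text \<open>
  The library class \<open>banach\<close> is a class of real spaces. The class below adds a complex scalar
  multiplication extending the real one, with respect to which the norm is homogeneous.
\<close>

class complex_banach = banach +
  fixes scaleC :: "complex \<Rightarrow> 'a \<Rightarrow> 'a"  (infixr "*\<^sub>C" 75)
  assumes scaleC_add_right: "c *\<^sub>C (x + y) = c *\<^sub>C x + c *\<^sub>C y"
    and scaleC_add_left: "(c + d) *\<^sub>C x = c *\<^sub>C x + d *\<^sub>C x"
    and scaleC_scaleC: "c *\<^sub>C (d *\<^sub>C x) = (c * d) *\<^sub>C x"
    and scaleC_of_real: "complex_of_real r *\<^sub>C x = r *\<^sub>R x"
    and norm_scaleC: "norm (c *\<^sub>C x) = cmod c * norm x"

instantiation complex :: complex_banach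
begin

definition "scaleC = ((*) :: complex \<Rightarrow> complex \<Rightarrow> complex)"

instance
  by standard (simp_all add: scaleC_complex_def distrib_left distrib_right mult.assoc
      scaleR_conv_of_real norm_mult)

end

lemma scaleC_one: "1 *\<^sub>C x = (x :: 'a::complex_banach)"
  using scaleC_of_real[of 1 x] by simp

lemma vector_space_scaleC: "vector_space (scaleC :: complex \<Rightarrow> 'a \<Rightarrow> 'a::complex_banach)"
  by unfold_locales (simp_all add: scaleC_add_right scaleC_add_left scaleC_scaleC scaleC_one)

abbreviation cspan :: "'a::complex_banach set \<Rightarrow> 'a set"
  where "cspan \<equiv> module.span scaleC"

definition infinite_dimensional :: "'a::complex_banach itself \<Rightarrow> bool"
  where "infinite_dimensional _ \<longleftrightarrow> \<not> (\<exists>S :: 'a set. finite S \<and> cspan S = UNIV)"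

text \<open>
  Elements of \<open>'a \<Rightarrow>\<^sub>L 'b\<close> are bounded and real linear, with \<open>norm\<close> the operator norm;
  complex linearity therefore only requires complex homogeneity.
\<close>

definition clinear_blinfun :: "('a::complex_banach \<Rightarrow>\<^sub>L 'b::complex_banach) \<Rightarrow> bool"
  where "clinear_blinfun f \<longleftrightarrow> (\<forall>c x. blinfun_apply f (c *\<^sub>C x) = c *\<^sub>C blinfun_apply f x)"

definition dual_space :: "('a::complex_banach \<Rightarrow>\<^sub>L complex) set"
  where "dual_space = {f. clinear_blinfun f}"

section \<open>Semigroups, generators and adjoints\<close>

text \<open>The values of \<open>T\<close> at negative times are irrelevant.\<close>

definition C0_semigroup :: "(real \<Rightarrow> 'a::complex_banach \<Rightarrow>\<^sub>L 'a) \<Rightarrow> bool"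
  where "C0_semigroup T \<longleftrightarrow>
    (\<forall>t\<ge>0. clinear_blinfun (T t)) \<and>
    T 0 = id_blinfun \<and>
    (\<forall>s\<ge>0. \<forall>t\<ge>0. T (s + t) = T s o\<^sub>L T t) \<and>
    (\<forall>x. ((\<lambda>t. T t x) \<longlongrightarrow> x) (at_right 0))"

definition generator_dom :: "(real \<Rightarrow> 'a::complex_banach \<Rightarrow>\<^sub>L 'a) \<Rightarrow> 'a set"
  where "generator_dom T = {x. \<exists>v. ((\<lambda>h. (T h x - x) /\<^sub>R h) \<longlongrightarrow> v) (at_right 0)}"

definition generator :: "(real \<Rightarrow> 'a::complex_banach \<Rightarrow>\<^sub>L 'a) \<Rightarrow> 'a \<Rightarrow> 'a"
  where "generator T x = Lim (at_right 0) (\<lambda>h. (T h x - x) /\<^sub>R h)"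

text \<open>Domain of the adjoint of the operator \<open>A\<close> with (dense) domain \<open>D\<close>.\<close>

definition adjoint_dom :: "'a::complex_banach set \<Rightarrow> ('a \<Rightarrow> 'a) \<Rightarrow> ('a \<Rightarrow>\<^sub>L complex) set"
  where "adjoint_dom D A =
    {f \<in> dual_space. \<exists>g \<in> dual_space. \<forall>x\<in>D. blinfun_apply f (A x) = blinfun_apply g x}"

definition admissible :: "(real \<Rightarrow> 'a::complex_banach \<Rightarrow>\<^sub>L 'a) \<Rightarrow> real \<Rightarrow> bool"
  where "admissible T \<omega> \<longleftrightarrow>
    (\<forall>t0>0. \<forall>\<epsilon>>0. \<forall>M :: 'a set.
      (\<exists>n::nat. \<exists>f :: nat \<Rightarrow> 'a \<Rightarrow>\<^sub>L complex.
         (\<forall>j\<in>{1..n}. f j \<in> adjoint_dom (generator_dom T) (generator T)) \<and>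
         M = (\<Inter>j\<in>{1..n}. {x. f j x = 0})) \<longrightarrow>
      (\<exists>x\<in>M. norm x = 1 \<and>
        (\<exists>\<mu>. Re \<mu> = \<omega> \<and>
          (\<forall>t\<in>{0..t0}. norm (T t x - exp (\<mu> * complex_of_real t) *\<^sub>C x) < \<epsilon>))))"

section \<open>The nonlinear integral equation\<close>

text \<open>Since the space is complete, precompact means relatively compact.\<close>

definition collectively_compact :: "(real \<Rightarrow> 'a::complex_banach \<Rightarrow> 'a) \<Rightarrow> bool"
  where "collectively_compact K \<longleftrightarrow>
    (\<forall>B t0. bounded B \<and> t0 \<ge> 0 \<longrightarrow> compact (closure ((\<lambda>(s, v). K s v) ` ({0..t0} \<times> B))))"

definition separately_continuous :: "(real \<Rightarrow> 'a::complex_banach \<Rightarrow> 'a) \<Rightarrow> bool"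
  where "separately_continuous K \<longleftrightarrow>
    (\<forall>v. continuous_on {0..} (\<lambda>s. K s v)) \<and> (\<forall>s\<ge>0. continuous_on UNIV (K s))"

text \<open>
  The library's Bochner integral needs a second countable space. The integral used here is the
  Henstock-Kurzweil integral, which extends the Bochner integral to which it reduces below: if
  \<open>K\<close> is collectively compact and separately continuous, \<open>T\<close> is a \<open>C\<^sub>0\<close>-semigroup and \<open>u\<close> is
  continuous, then the integrand is strongly measurable (a pointwise limit of the integrands
  for step functions in place of \<open>u\<close>) and bounded on \<open>{0..t}\<close>.
\<close>

definition is_solution ::
    "(real \<Rightarrow> 'a::complex_banach \<Rightarrow>\<^sub>L 'a) \<Rightarrow> (real \<Rightarrow> 'a \<Rightarrow> 'a) \<Rightarrow> 'a \<Rightarrow> (real \<Rightarrow> 'a) \<Rightarrow> bool"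
  where "is_solution T K x0 u \<longleftrightarrow>
    continuous_on {0..} u \<and>
    (\<forall>t\<ge>0. (\<lambda>s. T (t - s) (K s (u s))) integrable_on {0..t} \<and>
      u t = T t x0 + integral {0..t} (\<lambda>s. T (t - s) (K s (u s))))"

end

theory Submission
  imports Defs
begin

text \<open>
  By Duhamel's formula a solution is \<open>T(t)x\<^sub>0\<close> plus a nonlinear part, and for
  \<open>t \<le> \<tau>\<close> and all initial values in the ball together the nonlinear parts form a precompact set
  \<open>V(\<tau>)\<close> (\<open>nonlinear_part_totally_bounded\<close>). A precompact set cannot cancel vectors taken from a
  suitable subspace of finite codimension, so growth is produced by linear directions that
  are nearly transversal to everything the equation can add.

  Precisely, let \<open>\<beta> > \<alpha>\<close>. For a precompact set \<open>C\<close> there are finitely many functionals in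
  \<open>D(A\<^sup>*)\<close> such that \<open>\<parallel>m\<parallel> \<le> (1 + \<beta>) \<parallel>v + m\<parallel> + \<epsilon>\<close> for every \<open>v \<in> C\<close> and every \<open>m\<close> that they
  annihilate (\<open>annihilator_almost_transversal\<close>). They are obtained from norming functionals \<open>g\<close> of
  a finite net of \<open>C\<close>, given by the Hahn--Banach theorem, by averaging:
  \<open>h\<^sup>-\<^sup>1 \<integral>\<^sub>0\<^sup>h g \<circ> T(s) ds\<close> belongs to \<open>D(A\<^sup>*)\<close>, has norm at most \<open>\<beta>\<close> for small \<open>h\<close> and tends to
  \<open>g\<close> pointwise as \<open>h\<close> tends to \<open>0\<close>. This averaging is the source of the factor \<open>\<alpha>\<close> in the
  hypothesis. Admissibility then supplies, on any given \<open>[0, \<tau>]\<close>, unit vectors \<open>u\<close> in the common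
  kernel whose orbit is close to \<open>e\<^sup>\<mu>\<^sup>tu\<close> with \<open>Re \<mu> = \<omega>\<close> (\<open>transversal_growing_direction\<close>).

  The initial value is \<open>z = y + \<Sum> c\<^sub>k u\<^sub>k\<close> with \<open>c\<^sub>k = r (1 - q) q\<^sup>k\<close>, so that \<open>\<Sum> c\<^sub>k = r\<close>. Times
  \<open>s\<^sub>k\<close> with \<open>s\<^sub>0 = t\<^sub>0\<close> are fixed beforehand, the later ones so late that \<open>a\<close> is below a multiple of
  \<open>q\<^sup>k\<close> from \<open>s\<^sub>k\<close> on. Given \<open>u\<^sub>0, \<dots>, u\<^sub>k\<^sub>-\<^sub>1\<close>, the partial sum \<open>w\<close> is known, and \<open>u\<^sub>k\<close> is chosen transversal to
  the precompact set of all \<open>T(t)w + v\<close> with \<open>t \<le> s\<^sub>k\<^sub>+\<^sub>1\<close> and \<open>v \<in> V(s\<^sub>k\<^sub>+\<^sub>1)\<close>. Since \<open>V\<close> collects the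
  nonlinear parts for all initial values in the ball, it contains the one belonging to the
  still unknown \<open>z\<close>. Between \<open>s\<^sub>k\<close> and \<open>s\<^sub>k\<^sub>+\<^sub>1\<close> the solution has norm at least about
  \<open>c\<^sub>k e\<^sup>\<omega>\<^sup>t / (1 + \<beta>)\<close>, as the terms after the \<open>k\<close>-th have total size of order \<open>q c\<^sub>k e\<^sup>\<omega>\<^sup>t\<close>
  (\<open>large_solution_exists\<close>). Letting \<open>q\<close> tend to \<open>0\<close> and \<open>\<beta>\<close> to \<open>\<alpha>\<close>, every value of \<open>a(t\<^sub>0)\<close> below
  \<open>r / (1 + \<alpha>)\<close> is allowed, and \<open>r / (1 + \<alpha>) \<ge> r / (2\<alpha>)\<close> because \<open>\<alpha> \<ge> 1\<close>.
\<close>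

section \<open>Norming functionals on a complex normed space\<close>

text \<open>
  The Hahn--Banach theorem in the form of norming functionals: a sublinear functional that is
  minimal in the pointwise order is linear, and Zorn's lemma provides a minimal one below
  any given one.
\<close>

text \<open>
  For \<open>c > 0\<close> the inequality already implies \<open>p (c x) = c p x\<close>; in this form it passes to infima.
\<close>
definition sublinear :: "('a::real_vector \<Rightarrow> real) \<Rightarrow> bool"
  where "sublinear p \<longleftrightarrow> (\<forall>x y. p (x + y) \<le> p x + p y) \<and> (\<forall>c>0. \<forall>x. p (c *\<^sub>R x) \<le> c * p x)"

lemma sublinear_add: "sublinear p \<Longrightarrow> p (x + y) \<le> p x + p y"
  and sublinear_scale_le: "sublinear p \<Longrightarrow> c > 0 \<Longrightarrow> p (c *\<^sub>R x) \<le> c * p x"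
  by (auto simp: sublinear_def)

lemma sublinear_scale:
  assumes "sublinear p" "c > 0"
  shows "p (c *\<^sub>R x) = c * p x"
proof -
  have "p (inverse c *\<^sub>R (c *\<^sub>R x)) \<le> inverse c * p (c *\<^sub>R x)"
    using assms by (intro sublinear_scale_le) auto
  then have "c * p x \<le> p (c *\<^sub>R x)"
    using assms(2) by (simp add: field_simps)
  with sublinear_scale_le[OF assms, of x] show ?thesis by linarith
qed

lemma sublinear_zero:
  assumes "sublinear p"
  shows "p 0 = 0"
  using sublinear_scale[OF assms, of 2 0] by simp

lemma sublinear_minus: "sublinear p \<Longrightarrow> - p (- x) \<le> p x"
  using sublinear_add[of p x "- x"] by (simp add: sublinear_zero)

text \<open>
  Forcing the value at a given point: the largest sublinear functional \<open>q \<le> p\<close> that satisfies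
  \<open>q (- x0) = - p x0\<close> is an infimal convolution of \<open>p\<close> along the ray through \<open>x0\<close>. It serves
  both to normalise the functional to be constructed and to show that a minimal sublinear
  functional is additive.
\<close>

lemma sublinear_force_value:
  assumes p: "sublinear p"
  obtains q where "sublinear q" "\<And>x. q x \<le> p x" "\<And>x. q x \<le> p (x + x0) - p x0"
proof
  define \<phi> where "\<phi> = (\<lambda>x t. p (x + t *\<^sub>R x0) - t * p x0)"
  define q where "q = (\<lambda>x. INF t\<in>{0..}. \<phi> x t)"
  have lower: "- p (- x) \<le> \<phi> x t" if "t \<ge> 0" for x t
  proof -
    have "t * p x0 = p (t *\<^sub>R x0)"
      using sublinear_scale[OF p, of t x0] sublinear_zero[OF p] that by (cases "t = 0") auto
    also have "\<dots> \<le> p (x + t *\<^sub>R x0) + p (- x)"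
      using sublinear_add[OF p, of "x + t *\<^sub>R x0" "- x"] by simp
    finally show ?thesis by (simp add: \<phi>_def)
  qed
  then have bdd: "bdd_below (\<phi> x ` {0..})" for x
    by (auto intro!: bdd_belowI2)
  have q_le: "q x \<le> \<phi> x t" if "t \<ge> 0" for x t
    unfolding q_def using that by (intro cINF_lower bdd) auto
  have q_ge: "c \<le> q x" if "\<And>t. t \<ge> 0 \<Longrightarrow> c \<le> \<phi> x t" for c x
    unfolding q_def using that by (intro cINF_greatest) auto
  show "q x \<le> p x" for x
    using q_le[of 0 x] by (simp add: \<phi>_def)
  show "q x \<le> p (x + x0) - p x0" for x
    using q_le[of 1 x] by (simp add: \<phi>_def)
  have add: "q (x + y) \<le> q x + q y" for x y
  proof -
    have "q (x + y) \<le> \<phi> x s + \<phi> y t" if "s \<ge> 0" "t \<ge> 0" for s t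
    proof -
      have "q (x + y) \<le> \<phi> (x + y) (s + t)"
        using that by (intro q_le) auto
      also have "\<dots> \<le> \<phi> x s + \<phi> y t"
        using sublinear_add[OF p, of "x + s *\<^sub>R x0" "y + t *\<^sub>R x0"]
        by (simp add: \<phi>_def algebra_simps)
      finally show ?thesis .
    qed
    then have "q (x + y) - \<phi> x s \<le> q y" if "s \<ge> 0" for s
      using that by (intro q_ge) (auto simp: algebra_simps)
    then have "q (x + y) - q y \<le> q x"
      by (intro q_ge) (auto simp: algebra_simps)
    then show ?thesis by simp
  qed
  have scale: "q (c *\<^sub>R x) \<le> c * q x" if "c > 0" for c x
  proof -
    have "q (c *\<^sub>R x) / c \<le> q x"
    proof (rule q_ge)
      fix t :: real
      assume "t \<ge> 0"
      then have "q (c *\<^sub>R x) \<le> \<phi> (c *\<^sub>R x) (c * t)"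
        using that by (intro q_le) auto
      also have "\<dots> \<le> c * \<phi> x t"
        using sublinear_scale_le[OF p that, of "x + t *\<^sub>R x0"] by (simp add: \<phi>_def algebra_simps)
      finally show "q (c *\<^sub>R x) / c \<le> \<phi> x t"
        using that by (simp add: field_simps)
    qed
    then show ?thesis using that by (simp add: field_simps)
  qed
  show "sublinear q"
    using add scale by (simp add: sublinear_def)
qed

text \<open>
  The pointwise infimum of a chain is finite, because \<open>q x \<ge> - q (- x) \<ge> - p (- x)\<close> for every
  sublinear \<open>q \<le> p\<close>, and it is subadditive because of two members of a chain one lies below the
  other.
\<close>
lemma minimal_sublinear_exists:
  assumes p: "sublinear p"
  obtains g where "sublinear g" "\<And>x. g x \<le> p x"
    "\<And>q. sublinear q \<Longrightarrow> (\<And>x. q x \<le> g x) \<Longrightarrow> q = g"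
proof -
  define A where "A = {q. sublinear q \<and> (\<forall>x. q x \<le> p x)}"
  define P where "P = (\<lambda>q q' :: 'a \<Rightarrow> real. \<forall>x. q' x \<le> q x)"
  have "\<exists>g\<in>A. \<forall>q\<in>A. P g q \<longrightarrow> q = g"
  proof (rule predicate_Zorn)
    show "partial_order_on A (relation_of P A)"
    proof (rule partial_order_on_relation_ofI)
      show "P q q''" if "P q q'" "P q' q''" for q q' q''
        using that order_trans unfolding P_def by blast
      show "q = q'" if "P q q'" "P q' q" for q q'
        using that by (auto simp: P_def intro: order_antisym)
    qed (simp add: P_def)
    fix C
    assume C: "C \<in> Chains (relation_of P A)"
    have CA: "q \<in> A" if "q \<in> C" for q
      using C that by (auto simp: Chains_def relation_of_def)
    have chain: "P q q' \<or> P q' q" if "q \<in> C" "q' \<in> C" for q q'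
      using C that by (auto simp: Chains_def relation_of_def)
    show "\<exists>u\<in>A. \<forall>q\<in>C. P q u"
    proof (cases "C = {}")
      case True
      then show ?thesis using p by (auto simp: A_def)
    next
      case False
      define u where "u = (\<lambda>x. INF q\<in>C. q x)"
      have sub: "sublinear q" and le_p: "q x \<le> p x" if "q \<in> C" for q x
        using CA[OF that] by (auto simp: A_def)
      have "- p (- x) \<le> q x" if "q \<in> C" for q x
        using sublinear_minus[OF sub[OF that], of x] le_p[OF that, of "- x"] by linarith
      then have bdd: "bdd_below ((\<lambda>q. q x) ` C)" for x
        by (auto intro!: bdd_belowI2)
      have u_le: "u x \<le> q x" if "q \<in> C" for q x
        unfolding u_def using that by (intro cINF_lower bdd) auto
      have u_ge: "c \<le> u x" if "\<And>q. q \<in> C \<Longrightarrow> c \<le> q x" for c x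
        unfolding u_def using that False by (intro cINF_greatest) auto
      have add: "u (x + y) \<le> u x + u y" for x y
      proof -
        have "u (x + y) \<le> q x + q' y" if q: "q \<in> C" "q' \<in> C" for q q'
          using chain[OF q] u_le[OF q(1), of "x + y"] u_le[OF q(2), of "x + y"]
            sublinear_add[OF sub[OF q(1)], of x y] sublinear_add[OF sub[OF q(2)], of x y]
          unfolding P_def by (smt (verit))
        then have "u (x + y) - q x \<le> u y" if "q \<in> C" for q
          using that by (intro u_ge) (metis diff_le_eq add.commute)
        then have "u (x + y) - u y \<le> u x"
          by (intro u_ge) (auto simp: algebra_simps)
        then show ?thesis by simp
      qed
      have scale: "u (c *\<^sub>R x) \<le> c * u x" if "c > 0" for c x
      proof -
        have "u (c *\<^sub>R x) / c \<le> u x"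
        proof (rule u_ge)
          fix q
          assume "q \<in> C"
          then show "u (c *\<^sub>R x) / c \<le> q x"
            using u_le[of q "c *\<^sub>R x"] sublinear_scale_le[OF sub that, of q x] that
            by (simp add: field_simps)
        qed
        then show ?thesis using that by (simp add: field_simps)
      qed
      have "u x \<le> p x" for x
        using False u_le le_p order_trans by blast
      then have "u \<in> A"
        using add scale by (simp add: A_def sublinear_def)
      then show ?thesis
        using u_le by (auto simp: P_def)
    qed
  qed
  then obtain g where g: "g \<in> A" "\<forall>q\<in>A. P g q \<longrightarrow> q = g" by blast
  show thesis
  proof
    show "sublinear g" and le: "g x \<le> p x" for x
      using g(1) by (auto simp: A_def)
    show "q = g" if "sublinear q" "\<And>x. q x \<le> g x" for q
    proof -
      have "q \<in> A"
        using that le order_trans by (auto simp: A_def) blast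
      then show ?thesis using g(2) that by (auto simp: P_def)
    qed
  qed
qed

text \<open>
  Forcing the value at a point \<open>y\<close> yields a sublinear functional below \<open>g\<close>, hence \<open>g\<close> itself by
  minimality; the bound in \<open>sublinear_force_value\<close> then is superadditivity of \<open>g\<close>.
\<close>
lemma minimal_sublinear_linear:
  assumes g: "sublinear g"
    and min: "\<And>q. sublinear q \<Longrightarrow> (\<And>x. q x \<le> g x) \<Longrightarrow> q = g"
  shows "linear g"
proof -
  have add: "g (x + y) = g x + g y" for x y
  proof -
    obtain q where q: "sublinear q" "\<And>x. q x \<le> g x" "\<And>x. q x \<le> g (x + y) - g y"
      using sublinear_force_value[OF g] by blast
    have "q = g" using q by (intro min)
    then have "g x \<le> g (x + y) - g y" using q(3) by simp
    then show ?thesis using sublinear_add[OF g, of x y] by linarith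
  qed
  have minus: "g (- x) = - g x" for x
    using add[of x "- x"] sublinear_zero[OF g] by simp
  have "g (c *\<^sub>R x) = c *\<^sub>R g x" for c x
  proof (cases c "0 :: real" rule: linorder_cases)
    case less
    then show ?thesis using sublinear_scale[OF g, of "- c" x] minus[of "c *\<^sub>R x"] by simp
  qed (use sublinear_zero[OF g] sublinear_scale[OF g] in auto)
  with add show ?thesis by (intro linearI)
qed

text \<open>
  Below the norm with its value at \<open>v\<close> forced, every linear functional attains the norm of \<open>v\<close>.
\<close>
lemma real_norming_functional:
  fixes v :: "'a::real_normed_vector"
  obtains g where "linear g" "\<And>x. g x \<le> norm x" "g v = norm v"
proof -
  have norm: "sublinear (norm :: 'a \<Rightarrow> real)"
    by (simp add: sublinear_def norm_triangle_ineq)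
  obtain q where q: "sublinear q" "\<And>x. q x \<le> norm x" "\<And>x. q x \<le> norm (x + v) - norm v"
    using sublinear_force_value[OF norm] by blast
  obtain g where g: "sublinear g" "\<And>x. g x \<le> q x"
    and min: "\<And>h. sublinear h \<Longrightarrow> (\<And>x. h x \<le> g x) \<Longrightarrow> h = g"
    using minimal_sublinear_exists[OF q(1)] by blast
  have lin: "linear g"
    using g(1) min by (rule minimal_sublinear_linear)
  have le: "g x \<le> norm x" for x
    using g(2) q(2) order_trans by blast
  have "- g v \<le> - norm v"
    using g(2)[of "- v"] q(3)[of "- v"] linear_neg[OF lin, of v] by simp
  with le[of v] have "g v = norm v" by simp
  with lin le show thesis by (rule that)
qed

text \<open>
  The complex functional with real part \<open>h\<close> is \<open>x \<mapsto> h x - i h (i x)\<close>. Rotating \<open>x\<close> so that the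
  value becomes real and nonnegative transfers the norm bound from \<open>h\<close>.
\<close>
lemma complex_norming_functional:
  fixes v :: "'a::complex_banach"
  obtains g where "g \<in> dual_space" "norm g \<le> 1" "g v = complex_of_real (norm v)"
proof -
  obtain h where h: "linear h" "\<And>x. h x \<le> norm x" "h v = norm v"
    using real_norming_functional[of v] by blast
  define G :: "'a \<Rightarrow> complex" where "G = (\<lambda>x. Complex (h x) (- h (\<i> *\<^sub>C x)))"
  have h_scaleC: "h (c *\<^sub>C x) = Re c * h x + Im c * h (\<i> *\<^sub>C x)" for c x
  proof -
    have "c *\<^sub>C x = complex_of_real (Re c) *\<^sub>C x + complex_of_real (Im c) *\<^sub>C (\<i> *\<^sub>C x)"
      unfolding scaleC_scaleC scaleC_add_left[symmetric]
      using complex_eq[of c] by (simp add: mult.commute)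
    then show ?thesis
      by (simp add: scaleC_of_real linear_add[OF h(1)] linear_scale[OF h(1)])
  qed
  have G_scaleC: "G (c *\<^sub>C x) = c * G x" for c x
    unfolding G_def scaleC_scaleC
    by (simp add: h_scaleC[of c] h_scaleC[of "\<i> * c"] complex_eq_iff algebra_simps)
  have G_add: "G (x + w) = G x + G w" for x w
    by (simp add: G_def complex_eq_iff scaleC_add_right linear_add[OF h(1)])
  have G_le: "cmod (G x) \<le> norm x" for x
  proof (cases "G x = 0")
    case False
    define c where "c = cnj (G x) / cmod (G x)"
    have c: "cmod c = 1" using False by (simp add: c_def norm_divide)
    have "c * G x = complex_of_real (cmod (G x))"
      using False complex_norm_square[of "G x"] by (simp add: c_def power2_eq_square field_simps)
    then have "cmod (G x) = Re (G (c *\<^sub>C x))"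
      by (simp add: G_scaleC)
    also have "\<dots> = h (c *\<^sub>C x)"
      by (simp add: G_def)
    also have "\<dots> \<le> norm x"
      using h(2)[of "c *\<^sub>C x"] by (simp add: norm_scaleC c)
    finally show ?thesis .
  qed simp
  have "bounded_linear G"
    using G_le G_add G_scaleC[of "complex_of_real _"]
    by (intro bounded_linear_intro[of _ 1]) (auto simp: scaleC_of_real scaleR_conv_of_real)
  then have app: "blinfun_apply (Blinfun G) = G"
    by (rule bounded_linear_Blinfun_apply)
  show thesis
  proof
    show "Blinfun G \<in> dual_space"
      by (simp add: dual_space_def clinear_blinfun_def app G_scaleC scaleC_complex_def)
    show "norm (Blinfun G) \<le> 1"
      by (intro norm_blinfun_bound) (auto simp: app G_le)
    have "Re (G v) = norm v" by (simp add: G_def h)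
    moreover from this have "Im (G v) = 0"
      using G_le[of v] cmod_power2[of "G v"] power_mono[OF G_le[of v], of 2] by simp
    ultimately show "Blinfun G v = complex_of_real (norm v)"
      by (simp add: app complex_eq_iff)
  qed
qed

section \<open>Totally bounded sets and averages\<close>

lemma totally_bounded_norm_iff:
  fixes S :: "'b::real_normed_vector set"
  shows "totally_bounded S \<longleftrightarrow> (\<forall>e>0. \<exists>F. finite F \<and> (\<forall>x\<in>S. \<exists>p\<in>F. norm (x - p) < e))"
  unfolding totally_bounded_metric by (simp add: subset_eq dist_norm norm_minus_commute)

text \<open>
  It suffices to approximate by totally bounded sets that may depend on the accuracy; this
  reduces precompactness of orbits and of integrals to finitely many vectors.
\<close>
lemma totally_bounded_near:
  fixes S :: "'b::real_normed_vector set"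
  assumes "\<And>e. e > 0 \<Longrightarrow> \<exists>D. totally_bounded D \<and> (\<forall>x\<in>S. \<exists>p\<in>D. norm (x - p) \<le> e)"
  shows "totally_bounded S"
  unfolding totally_bounded_norm_iff
proof (intro allI impI)
  fix e :: real
  assume "e > 0"
  then obtain D where D: "totally_bounded D" "\<And>x. x \<in> S \<Longrightarrow> \<exists>p\<in>D. norm (x - p) \<le> e / 2"
    using assms[of "e / 2"] by auto
  obtain F where F: "finite F" "\<And>p. p \<in> D \<Longrightarrow> \<exists>p'\<in>F. norm (p - p') < e / 2"
    using D(1) \<open>e > 0\<close> unfolding totally_bounded_norm_iff by (meson half_gt_zero)
  have "\<exists>p'\<in>F. norm (x - p') < e" if x: "x \<in> S" for x
  proof -
    obtain p where p: "p \<in> D" "norm (x - p) \<le> e / 2"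
      using D(2)[OF x] by blast
    obtain p' where p': "p' \<in> F" "norm (p - p') < e / 2"
      using F(2)[OF p(1)] by blast
    have "norm (x - p') < e"
      using norm_triangle_ineq[of "x - p" "p - p'"] p(2) p'(2) by simp
    with p'(1) show ?thesis by blast
  qed
  with F(1) show "\<exists>F. finite F \<and> (\<forall>x\<in>S. \<exists>p\<in>F. norm (x - p) < e)" by blast
qed

lemma compact_imp_totally_bounded: "compact (S :: 'b::real_normed_vector set) \<Longrightarrow> totally_bounded S"
  by (auto simp: compact_eq_totally_bounded totally_bounded_metric ball_def)

lemma totally_bounded_sums:
  fixes S S' :: "'b::real_normed_vector set"
  assumes "totally_bounded S" "totally_bounded S'"
  shows "totally_bounded {x + x' | x x'. x \<in> S \<and> x' \<in> S'}"
  unfolding totally_bounded_norm_iff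
proof (intro allI impI)
  fix e :: real
  assume "e > 0"
  obtain F where F: "finite F" "\<And>x. x \<in> S \<Longrightarrow> \<exists>p\<in>F. norm (x - p) < e / 2"
    using assms(1) \<open>e > 0\<close> unfolding totally_bounded_norm_iff by (meson half_gt_zero)
  obtain F' where F': "finite F'" "\<And>x. x \<in> S' \<Longrightarrow> \<exists>p\<in>F'. norm (x - p) < e / 2"
    using assms(2) \<open>e > 0\<close> unfolding totally_bounded_norm_iff by (meson half_gt_zero)
  define G where "G = (\<lambda>(p, p'). p + p') ` (F \<times> F')"
  have "\<exists>q\<in>G. norm (x + x' - q) < e" if x: "x \<in> S" "x' \<in> S'" for x x'
  proof -
    obtain p p' where p: "p \<in> F" "norm (x - p) < e / 2" "p' \<in> F'" "norm (x' - p') < e / 2"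
      using F(2)[OF x(1)] F'(2)[OF x(2)] by blast
    have "norm (x + x' - (p + p')) < e"
      using norm_diff_triangle_ineq[of x x' p p'] p by simp
    moreover have "p + p' \<in> G"
      using p by (auto simp: G_def)
    ultimately show ?thesis by blast
  qed
  moreover have "finite G"
    using F(1) F'(1) by (simp add: G_def)
  ultimately show "\<exists>G. finite G \<and> (\<forall>x\<in>{x + x' | x x'. x \<in> S \<and> x' \<in> S'}. \<exists>p\<in>G. norm (x - p) < e)"
    by blast
qed

text \<open>
  A Riemann sum of \<open>f\<close> is close to the same sum with each value replaced by a nearby point of
  \<open>F\<close>, which is \<open>t\<close> times a convex combination. One error \<open>e t\<close> comes from this replacement, the
  other from the Riemann sum.
\<close>
lemma integral_near_convex_hull:
  fixes f :: "real \<Rightarrow> 'b::real_normed_vector"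
  assumes f: "f integrable_on {0..t}" and "t > 0" "e > 0"
    and near: "\<And>s. s \<in> {0..t} \<Longrightarrow> \<exists>p\<in>F. norm (f s - p) \<le> e"
  shows "\<exists>h\<in>convex hull F. norm (integral {0..t} f - t *\<^sub>R h) \<le> 2 * e * t"
proof -
  obtain P where P: "\<And>s. s \<in> {0..t} \<Longrightarrow> P s \<in> F \<and> norm (f s - P s) \<le> e"
    using near by metis
  have "(f has_integral integral {0..t} f) {0..t}"
    using f by (rule integrable_integral)
  then obtain \<gamma> where \<gamma>: "gauge \<gamma>" "\<And>D. D tagged_division_of {0..t} \<Longrightarrow> \<gamma> fine D \<Longrightarrow>
      norm ((\<Sum>(x, k)\<in>D. measure lborel k *\<^sub>R f x) - integral {0..t} f) \<le> e * measure lborel {0..t}"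
    using \<open>e > 0\<close> unfolding has_integral_factor_content_real by metis
  obtain D where D: "D tagged_division_of {0..t}" "\<gamma> fine D"
    using fine_division_exists_real[OF \<gamma>(1)] by blast
  have tag: "x \<in> {0..t}" if "(x, k) \<in> D" for x k
    using tagged_division_ofD(2,3)[OF D(1) that] by blast
  have total: "(\<Sum>(x, k)\<in>D. measure lborel k) = t"
    using additive_content_tagged_division[of D 0 t] D(1) \<open>t > 0\<close> by simp
  define h where "h = (\<Sum>i\<in>D. (measure lborel (snd i) / t) *\<^sub>R P (fst i))"
  have "h \<in> convex hull F"
    unfolding h_def
  proof (rule convex_sum)
    show "finite D" using D(1) by (rule tagged_division_of_finite)
    show "(\<Sum>i\<in>D. measure lborel (snd i) / t) = 1"
      using total \<open>t > 0\<close> by (simp add: sum_divide_distrib[symmetric] case_prod_beta)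
    show "P (fst i) \<in> convex hull F" if "i \<in> D" for i
      using P[of "fst i"] tag[of "fst i" "snd i"] that by (auto intro: hull_inc)
  qed (use \<open>t > 0\<close> in auto)
  moreover have "norm (integral {0..t} f - t *\<^sub>R h) \<le> 2 * e * t"
  proof -
    have "t *\<^sub>R h = (\<Sum>(x, k)\<in>D. measure lborel k *\<^sub>R P x)"
      using \<open>t > 0\<close> by (simp add: h_def scaleR_sum_right case_prod_beta)
    then have "norm ((\<Sum>(x, k)\<in>D. measure lborel k *\<^sub>R f x) - t *\<^sub>R h)
        = norm (\<Sum>(x, k)\<in>D. measure lborel k *\<^sub>R (f x - P x))"
      by (simp add: case_prod_beta scaleR_diff_right sum_subtractf)
    also have "\<dots> \<le> (\<Sum>(x, k)\<in>D. measure lborel k * e)"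
      using P tag by (intro sum_norm_le) (auto intro!: mult_left_mono)
    also have "\<dots> = e * t"
      by (simp add: total[symmetric] sum_distrib_left case_prod_beta mult.commute)
    finally have "norm ((\<Sum>(x, k)\<in>D. measure lborel k *\<^sub>R f x) - t *\<^sub>R h) \<le> e * t" .
    moreover have "norm ((\<Sum>(x, k)\<in>D. measure lborel k *\<^sub>R f x) - integral {0..t} f) \<le> e * t"
      using \<gamma>(2)[OF D] \<open>t > 0\<close> by simp
    ultimately show ?thesis
      using norm_triangle_ineq4[of "(\<Sum>(x, k)\<in>D. measure lborel k *\<^sub>R f x) - t *\<^sub>R h"
          "(\<Sum>(x, k)\<in>D. measure lborel k *\<^sub>R f x) - integral {0..t} f"]
      by simp
  qed
  ultimately show ?thesis by blast
qed


lemma right_average_tendsto: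
  fixes \<psi> :: "real \<Rightarrow> 'b::banach"
  assumes "continuous_on {a..} \<psi>"
  shows "((\<lambda>d. integral {a..a + d} \<psi> /\<^sub>R d) \<longlongrightarrow> \<psi> a) (at_right 0)"
proof (rule tendstoI)
  fix e :: real
  assume e: "e > 0"
  have "(\<psi> \<longlongrightarrow> \<psi> a) (at a within {a..})"
    using assms by (simp add: continuous_on)
  then have "\<forall>\<^sub>F s in at a within {a..}. dist (\<psi> s) (\<psi> a) < e / 2"
    using e by (intro tendstoD) auto
  then obtain \<delta> where \<delta>: "\<delta> > 0" "\<And>s. s \<in> {a..} \<Longrightarrow> s \<noteq> a \<Longrightarrow> dist s a < \<delta> \<Longrightarrow> dist (\<psi> s) (\<psi> a) < e / 2"
    unfolding eventually_at by blast
  have close: "norm (\<psi> s - \<psi> a) \<le> e / 2" if "a \<le> s" "s < a + \<delta>" for s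
    using \<delta>(2)[of s] that e by (cases "s = a") (auto simp: dist_norm intro: less_imp_le)
  have "dist (integral {a..a + d} \<psi> /\<^sub>R d) (\<psi> a) < e" if d: "0 < d" "d < \<delta>" for d
  proof -
    have cont: "continuous_on {a..a + d} \<psi>"
      using assms by (rule continuous_on_subset) auto
    have "integral {a..a + d} \<psi> - d *\<^sub>R \<psi> a = integral {a..a + d} (\<lambda>s. \<psi> s - \<psi> a)"
      using d by (subst integral_diff) (auto intro!: integrable_continuous_real cont)
    moreover have "norm (integral {a..a + d} (\<lambda>s. \<psi> s - \<psi> a)) \<le> e / 2 * (a + d - a)"
      using d by (intro integral_bound continuous_intros cont close) auto
    ultimately have "norm (integral {a..a + d} \<psi> - d *\<^sub>R \<psi> a) \<le> d * (e / 2)"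
      by (simp add: mult.commute)
    moreover have "integral {a..a + d} \<psi> /\<^sub>R d - \<psi> a = (integral {a..a + d} \<psi> - d *\<^sub>R \<psi> a) /\<^sub>R d"
      using d by (simp add: scaleR_diff_right)
    ultimately have "norm (integral {a..a + d} \<psi> /\<^sub>R d - \<psi> a) \<le> e / 2"
      using d by (simp add: divide_simps mult.commute)
    then show ?thesis using e by (simp add: dist_norm)
  qed
  then show "\<forall>\<^sub>F d in at_right 0. dist (integral {a..a + d} \<psi> /\<^sub>R d) (\<psi> a) < e"
    using \<delta>(1) by (auto simp: eventually_at_right_field)
qed


section \<open>Functionals in the domain of the adjoint generator\<close>

text \<open>
  The bound \<open>\<beta>\<close> near \<open>0\<close> will be a number slightly above \<open>\<alpha>\<close>.
\<close>

context
  fixes T :: "real \<Rightarrow> 'a::complex_banach \<Rightarrow>\<^sub>L 'a" and \<beta> :: real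
  assumes T: "C0_semigroup T"
    and near_0: "\<forall>\<^sub>F t in at_right 0. norm (T t) < \<beta>" and \<beta>: "\<beta> \<ge> 1"
begin

lemma semigroup_zero: "T 0 x = x"
  using T by (simp add: C0_semigroup_def)

lemma semigroup_add: "s \<ge> 0 \<Longrightarrow> t \<ge> 0 \<Longrightarrow> T (s + t) x = T s (T t x)"
  using T by (simp add: C0_semigroup_def)

lemma semigroup_scaleC: "t \<ge> 0 \<Longrightarrow> T t (c *\<^sub>C x) = c *\<^sub>C T t x"
  using T by (simp add: C0_semigroup_def clinear_blinfun_def)

lemma semigroup_tendsto_0: "((\<lambda>t. T t x) \<longlongrightarrow> x) (at_right 0)"
  using T by (simp add: C0_semigroup_def)

text \<open>
  Here \<open>\<beta> \<ge> 1\<close> is what covers \<open>t = 0\<close>, which the filter \<open>at_right 0\<close> leaves out.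
\<close>
lemma norm_semigroup_near_0:
  obtains d where "d > 0" "\<And>t. 0 \<le> t \<Longrightarrow> t \<le> d \<Longrightarrow> norm (T t) \<le> \<beta>"
proof -
  obtain d where d: "d > 0" "\<And>t. 0 < t \<Longrightarrow> t < d \<Longrightarrow> norm (T t) < \<beta>"
    using near_0 by (auto simp: eventually_at_right_field)
  have "norm (T 0) \<le> 1"
    by (intro norm_blinfun_bound) (auto simp: semigroup_zero)
  then have "norm (T t) \<le> \<beta>" if "0 \<le> t" "t \<le> d / 2" for t
    using d(2)[of t] d(1) that \<beta> by (cases "t = 0") auto
  with d(1) show thesis by (intro that[of "d / 2"]) auto
qed

lemma norm_semigroup_bounded:
  obtains M where "M \<ge> 1" "\<And>t x. 0 \<le> t \<Longrightarrow> t \<le> \<tau> \<Longrightarrow> norm (T t x) \<le> M * norm x"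
proof -
  obtain d where d: "d > 0" "\<And>t. 0 \<le> t \<Longrightarrow> t \<le> d \<Longrightarrow> norm (T t) \<le> \<beta>"
    using norm_semigroup_near_0 by blast
  have small: "norm (T t x) \<le> \<beta> * norm x" if "0 \<le> t" "t \<le> d" for t x
    using norm_blinfun mult_right_mono[OF d(2)[OF that] norm_ge_zero] by (rule order_trans)
  have bound: "norm (T t x) \<le> \<beta> ^ Suc n * norm x" if "0 \<le> t" "t \<le> real (Suc n) * d" for n t x
    using that
  proof (induction n arbitrary: t)
    case 0
    then show ?case by (simp add: small)
  next
    case (Suc n)
    show ?case
    proof (cases "t \<le> d")
      case True
      have "norm (T t x) \<le> \<beta> * norm x"
        using Suc.prems(1) True by (rule small)
      also have "\<dots> \<le> \<beta> ^ Suc (Suc n) * norm x"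
        using \<beta> power_increasing[of 1 "Suc (Suc n)" \<beta>] by (intro mult_right_mono) auto
      finally show ?thesis .
    next
      case False
      have "T t x = T d (T (t - d) x)"
        using semigroup_add[of d "t - d" x] d(1) False by simp
      also have "norm \<dots> \<le> \<beta> * norm (T (t - d) x)"
        using d(1) by (intro small) auto
      also have "\<dots> \<le> \<beta> * (\<beta> ^ Suc n * norm x)"
        using Suc.prems False \<beta> by (intro mult_left_mono Suc.IH) (auto simp: algebra_simps)
      finally show ?thesis by (simp add: mult.assoc)
    qed
  qed
  obtain n where "\<tau> / d \<le> real n"
    using real_arch_simple by blast
  then have "\<tau> \<le> real (Suc n) * d"
    using d(1) by (simp add: field_simps)
  then have "norm (T t x) \<le> \<beta> ^ Suc n * norm x" if "0 \<le> t" "t \<le> \<tau>" for t x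
    using that by (intro bound) auto
  moreover have "\<beta> ^ Suc n \<ge> 1"
    using \<beta> by (rule one_le_power)
  ultimately show thesis by (rule that[rotated])
qed

text \<open>
  Continuity from the left comes from \<open>T u x - T s x = T s (T (u - s) x - x)\<close>: the operator at
  the earlier time is bounded uniformly.
\<close>
lemma continuous_on_orbit: "continuous_on {0..} (\<lambda>t. T t x)"
  unfolding continuous_on_iff
proof (intro ballI allI impI)
  fix t e :: real
  assume t: "t \<in> {0..}" and e: "e > 0"
  obtain M where M: "M \<ge> 1" "\<And>s x. 0 \<le> s \<Longrightarrow> s \<le> t + 1 \<Longrightarrow> norm (T s x) \<le> M * norm x"
    using norm_semigroup_bounded by blast
  have "\<forall>\<^sub>F h in at_right 0. dist (T h x) x < e / M"
    using semigroup_tendsto_0 e M(1) by (intro tendstoD) auto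
  then obtain d where d: "d > 0" "\<And>h. 0 < h \<Longrightarrow> h < d \<Longrightarrow> dist (T h x) x < e / M"
    by (auto simp: eventually_at_right_field)
  have main: "norm (T u x - T s x) < e" if s: "0 \<le> s" "s \<le> u" "s \<le> t + 1" "u - s < d" for s u
  proof -
    have "T u x - T s x = T s (T (u - s) x - x)"
      using semigroup_add[of s "u - s" x] s by (simp add: blinfun.diff_right)
    also have "norm \<dots> \<le> M * norm (T (u - s) x - x)"
      using s by (intro M(2))
    also have "norm (T (u - s) x - x) < e / M"
      using d(2)[of "u - s"] s e M(1) by (cases "u = s") (auto simp: dist_norm semigroup_zero)
    finally show ?thesis using M(1) by (simp add: field_simps)
  qed
  have "dist (T s x) (T t x) < e" if "s \<in> {0..}" "dist s t < min d 1" for s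
    using main[of s t] main[of t s] that t
    by (cases "s \<le> t") (auto simp: dist_norm norm_minus_commute)
  then show "\<exists>d>0. \<forall>s\<in>{0..}. dist s t < d \<longrightarrow> dist (T s x) (T t x) < e"
    using d(1) by (intro exI[of _ "min d 1"]) auto
qed

text \<open>
  The averages of \<open>g \<circ> T s\<close> over \<open>[0, h]\<close> lie in the domain of the adjoint, and the adjoint
  maps them to \<open>(g \<circ> T h - g) / h\<close>. Instead of differentiating orbits, the difference quotient
  of \<open>T\<close> at \<open>0\<close> is inserted: shifting the integral by \<open>d\<close> leaves the averages over \<open>[h, h + d]\<close> and
  over \<open>[0, d]\<close>, whose limits are the boundary values.
\<close>
lemma averaged_functional:
  assumes g: "g \<in> dual_space" and h: "h > 0" "\<And>t. 0 \<le> t \<Longrightarrow> t \<le> h \<Longrightarrow> norm (T t) \<le> \<beta>"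
  obtains G where "G \<in> adjoint_dom (generator_dom T) (generator T)"
    "\<And>x. G x = integral {0..h} (\<lambda>s. g (T s x)) /\<^sub>R h" "norm G \<le> \<beta> * norm g"
proof -
  define J where "J = (\<lambda>x. integral {0..h} (\<lambda>s. g (T s x)) /\<^sub>R h)"
  have cont: "continuous_on {0..} (\<lambda>s. g (T s x))" for x
    by (intro continuous_intros continuous_on_orbit)
  have cont': "continuous_on {a..b} (\<lambda>s. g (T s x))" if "a \<ge> 0" for x a b
    using cont by (rule continuous_on_subset) (use that in auto)
  have int: "(\<lambda>s. g (T s x)) integrable_on {a..b}" if "a \<ge> 0" for x a b
    using that by (intro integrable_continuous_real cont')
  have J_le: "norm (J x) \<le> norm x * (\<beta> * norm g)" for x
  proof -
    have "norm (integral {0..h} (\<lambda>s. g (T s x))) \<le> (norm g * (\<beta> * norm x)) * (h - 0)"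
    proof (intro integral_bound cont')
      fix s assume s: "s \<in> {0..h}"
      have "norm (T s x) \<le> \<beta> * norm x"
        using s by (intro order_trans[OF norm_blinfun] mult_right_mono h(2)) auto
      then show "norm (g (T s x)) \<le> norm g * (\<beta> * norm x)"
        by (rule order_trans[OF norm_blinfun mult_left_mono]) simp
    qed (use h(1) in auto)
    then have "norm (integral {0..h} (\<lambda>s. g (T s x))) / h \<le> norm g * (\<beta> * norm x)"
      using h(1) by (simp add: pos_divide_le_eq)
    then show ?thesis
      using h(1) by (simp add: J_def divide_inverse mult_ac)
  qed
  have J_add: "J (x + w) = J x + J w" for x w
    by (simp add: J_def blinfun.add_right integral_add int scaleR_add_right)
  have J_scaleC: "J (c *\<^sub>C x) = c * J x" for c x
  proof -
    have "integral {0..h} (\<lambda>s. g (T s (c *\<^sub>C x))) = integral {0..h} (\<lambda>s. c * g (T s x))"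
      using g by (intro integral_cong)
        (auto simp: semigroup_scaleC dual_space_def clinear_blinfun_def scaleC_complex_def)
    then show ?thesis by (simp add: J_def)
  qed
  have "bounded_linear J"
    using J_le J_add J_scaleC[of "complex_of_real _"]
    by (intro bounded_linear_intro) (auto simp: scaleC_of_real scaleR_conv_of_real)
  then have J: "blinfun_apply (Blinfun J) = J"
    by (rule bounded_linear_Blinfun_apply)
  define G' where "G' = ((g o\<^sub>L T h) - g) /\<^sub>R h"
  have "J (generator T x) = G' x" if "x \<in> generator_dom T" for x
  proof -
    obtain v where v: "((\<lambda>d. (T d x - x) /\<^sub>R d) \<longlongrightarrow> v) (at_right 0)"
      using \<open>x \<in> generator_dom T\<close> by (auto simp: generator_dom_def)
    have "generator T x = v"
      unfolding generator_def using v by (intro tendsto_Lim) auto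
    have "((\<lambda>d. J ((T d x - x) /\<^sub>R d)) \<longlongrightarrow> J v) (at_right 0)"
      using blinfun.tendsto[OF tendsto_const v, of "Blinfun J"] by (simp add: J)
    moreover have "((\<lambda>d. J ((T d x - x) /\<^sub>R d)) \<longlongrightarrow> G' x) (at_right 0)"
    proof (rule Lim_transform_eventually)
      let ?\<phi> = "\<lambda>s. g (T s x)"
      have "((\<lambda>d. integral {h..h + d} ?\<phi> /\<^sub>R d) \<longlongrightarrow> ?\<phi> h) (at_right 0)"
        using h(1) by (intro right_average_tendsto continuous_on_subset[OF cont]) auto
      moreover have "((\<lambda>d. integral {0..0 + d} ?\<phi> /\<^sub>R d) \<longlongrightarrow> ?\<phi> 0) (at_right 0)"
        by (intro right_average_tendsto cont)
      ultimately have "((\<lambda>d. (integral {h..h + d} ?\<phi> /\<^sub>R d - integral {0..0 + d} ?\<phi> /\<^sub>R d) /\<^sub>R h)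
          \<longlongrightarrow> (?\<phi> h - ?\<phi> 0) /\<^sub>R h) (at_right 0)"
        by (intro tendsto_scaleR tendsto_diff tendsto_const)
      then show "((\<lambda>d. (integral {h..h + d} ?\<phi> /\<^sub>R d - integral {0..0 + d} ?\<phi> /\<^sub>R d) /\<^sub>R h)
          \<longlongrightarrow> G' x) (at_right 0)"
        by (simp add: G'_def blinfun.diff_left blinfun.scaleR_left semigroup_zero)
      have "(integral {h..h + d} ?\<phi> /\<^sub>R d - integral {0..0 + d} ?\<phi> /\<^sub>R d) /\<^sub>R h
          = J ((T d x - x) /\<^sub>R d)" if d: "d > 0" for d
      proof -
        have "integral {0..h} (\<lambda>s. g (T s (T d x))) = integral {0..h} (\<lambda>s. ?\<phi> (s + d))"
          using d by (intro integral_cong) (auto simp: semigroup_add)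
        also have "\<dots> = integral {d..h + d} ?\<phi>"
          using integral_shift_real_ivl[of d d "h + d" ?\<phi>] by simp
        finally have shift: "integral {0..h} (\<lambda>s. g (T s (T d x))) = integral {d..h + d} ?\<phi>" .
        have "integral {0..d} ?\<phi> + integral {d..h + d} ?\<phi> = integral {0..h + d} ?\<phi>"
          using d h(1) by (intro Henstock_Kurzweil_Integration.integral_combine int) auto
        moreover have "integral {0..h} ?\<phi> + integral {h..h + d} ?\<phi> = integral {0..h + d} ?\<phi>"
          using d h(1) by (intro Henstock_Kurzweil_Integration.integral_combine int) auto
        moreover have "b - p = q - u" if "u + b = c" "p + q = c" for b c p q u :: complex
          using that by (auto simp: algebra_simps)
        ultimately have eq: "integral {d..h + d} ?\<phi> - integral {0..h} ?\<phi>
            = integral {h..h + d} ?\<phi> - integral {0..d} ?\<phi>"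
          by blast
        have "J ((T d x - x) /\<^sub>R d) = (J (T d x) - J x) /\<^sub>R d"
          using \<open>bounded_linear J\<close> by (simp add: linear_simps)
        also have "J (T d x) - J x = (integral {d..h + d} ?\<phi> - integral {0..h} ?\<phi>) /\<^sub>R h"
          by (simp only: J_def shift scaleR_diff_right)
        also have "\<dots> /\<^sub>R d = (integral {h..h + d} ?\<phi> /\<^sub>R d - integral {0..0 + d} ?\<phi> /\<^sub>R d) /\<^sub>R h"
          by (simp only: eq scaleR_diff_right scaleR_left_commute[of "inverse h"] add_0)
        finally show ?thesis by (rule sym)
      qed
      then show "\<forall>\<^sub>F d in at_right 0. (integral {h..h + d} ?\<phi> /\<^sub>R d - integral {0..0 + d} ?\<phi> /\<^sub>R d) /\<^sub>R h
          = J ((T d x - x) /\<^sub>R d)"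
        by (intro eventually_mono[OF eventually_at_right_less[of 0]])
    qed
    ultimately show ?thesis
      unfolding \<open>generator T x = v\<close> by (rule tendsto_unique[OF trivial_limit_at_right_real])
  qed
  moreover have "G' \<in> dual_space"
    using g h(1) by (simp add: G'_def dual_space_def clinear_blinfun_def blinfun.diff_left blinfun.scaleR_left
        semigroup_scaleC scaleC_complex_def algebra_simps)
  moreover have "Blinfun J \<in> dual_space"
    by (simp add: dual_space_def clinear_blinfun_def J J_scaleC scaleC_complex_def)
  ultimately have "Blinfun J \<in> adjoint_dom (generator_dom T) (generator T)"
    by (auto simp: adjoint_dom_def J)
  moreover have "norm (Blinfun J) \<le> \<beta> * norm g"
    using J_le \<beta> by (intro norm_blinfun_bound) (auto simp: J mult.commute)
  moreover have "Blinfun J x = integral {0..h} (\<lambda>s. g (T s x)) /\<^sub>R h" for x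
    unfolding J by (simp add: J_def)
  ultimately show thesis
    by (intro that)
qed

text \<open>
  The domain of the adjoint is only weak-* dense, so norming functionals exist in it only
  approximately and at the price of the norm bound \<open>\<beta>\<close>.
\<close>
lemma adjoint_dom_almost_norming:
  assumes "\<epsilon> > 0"
  obtains G where "G \<in> adjoint_dom (generator_dom T) (generator T)"
    "norm G \<le> \<beta>" "cmod (G v) > norm v - \<epsilon>"
proof -
  obtain g where g: "g \<in> dual_space" "norm g \<le> 1" "g v = complex_of_real (norm v)"
    using complex_norming_functional[of v] by blast
  obtain d where d: "d > 0" "\<And>t. 0 \<le> t \<Longrightarrow> t \<le> d \<Longrightarrow> norm (T t) \<le> \<beta>"
    using norm_semigroup_near_0 by blast
  have "continuous_on {0..} (\<lambda>s. g (T s v))"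
    by (intro continuous_intros continuous_on_orbit)
  from right_average_tendsto[OF this]
  have "((\<lambda>h. integral {0..h} (\<lambda>s. g (T s v)) /\<^sub>R h) \<longlongrightarrow> g v) (at_right 0)"
    by (simp add: semigroup_zero)
  then have "\<forall>\<^sub>F h in at_right 0. dist (integral {0..h} (\<lambda>s. g (T s v)) /\<^sub>R h) (g v) < \<epsilon>"
    using \<open>\<epsilon> > 0\<close> by (rule tendstoD)
  then obtain d' where d': "d' > 0"
      "\<And>h. 0 < h \<Longrightarrow> h < d' \<Longrightarrow> dist (integral {0..h} (\<lambda>s. g (T s v)) /\<^sub>R h) (g v) < \<epsilon>"
    by (auto simp: eventually_at_right_field)
  define h where "h = min d (d' / 2)"
  have h: "0 < h" "h \<le> d" "h < d'"
    using d(1) d'(1) by (auto simp: h_def)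
  have h_le: "norm (T t) \<le> \<beta>" if "0 \<le> t" "t \<le> h" for t
    using that h(2) by (intro d(2)) auto
  obtain G where G: "G \<in> adjoint_dom (generator_dom T) (generator T)"
      "G v = integral {0..h} (\<lambda>s. g (T s v)) /\<^sub>R h" "norm G \<le> \<beta> * norm g"
    using averaged_functional[OF g(1) h(1) h_le] by blast
  have "\<beta> * norm g \<le> \<beta>"
    using g(2) \<beta> by (simp add: mult_left_le)
  moreover have "norm v - \<epsilon> < cmod (G v)"
    using d'(2)[OF h(1,3)] norm_triangle_ineq2[of "g v" "G v"] g(3)
    by (simp add: G(2) dist_norm norm_minus_commute)
  ultimately show thesis
    using G by (intro that) auto
qed


section \<open>Precompactness of the nonlinear part\<close>

lemma totally_bounded_orbit: "totally_bounded ((\<lambda>t. T t x) ` {0..\<tau>})"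
proof (intro compact_imp_totally_bounded compact_continuous_image)
  show "continuous_on {0..\<tau>} (\<lambda>t. T t x)"
    using continuous_on_orbit by (rule continuous_on_subset) auto
qed simp

text \<open>
  Uniform boundedness of \<open>T\<close> on \<open>[0, \<tau>]\<close> reduces this to the orbits of a finite net of \<open>Q\<close>.
\<close>
lemma totally_bounded_orbits:
  assumes Q: "totally_bounded Q"
  shows "totally_bounded {T t v | t v. 0 \<le> t \<and> t \<le> \<tau> \<and> v \<in> Q}"
proof (rule totally_bounded_near)
  fix e :: real
  assume e: "e > 0"
  obtain M where M: "M \<ge> 1" "\<And>t x. 0 \<le> t \<Longrightarrow> t \<le> \<tau> \<Longrightarrow> norm (T t x) \<le> M * norm x"
    using norm_semigroup_bounded by blast
  have "e / M > 0" using e M(1) by simp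
  then obtain F where F: "finite F" "\<And>v. v \<in> Q \<Longrightarrow> \<exists>p\<in>F. norm (v - p) < e / M"
    using Q unfolding totally_bounded_norm_iff by meson
  define D where "D = (\<Union>p\<in>F. (\<lambda>t. T t p) ` {0..\<tau>})"
  have "totally_bounded D"
    unfolding D_def using F(1) totally_bounded_orbit by (intro totally_bounded_Union) auto
  moreover have "\<exists>p\<in>D. norm (T t v - p) \<le> e" if tv: "0 \<le> t" "t \<le> \<tau>" "v \<in> Q" for t v
  proof -
    obtain p where p: "p \<in> F" "norm (v - p) < e / M"
      using F(2) tv(3) by blast
    have "norm (T t v - T t p) \<le> M * norm (v - p)"
      using M(2)[OF tv(1,2), of "v - p"] by (simp add: blinfun.diff_right)
    also have "\<dots> \<le> e"
      using p(2) M(1) by (simp add: field_simps)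
    finally have "norm (T t v - T t p) \<le> e" .
    moreover have "T t p \<in> D"
      unfolding D_def using p(1) tv by force
    ultimately show ?thesis by blast
  qed
  ultimately show "\<exists>D. totally_bounded D \<and>
      (\<forall>x\<in>{T t v | t v. 0 \<le> t \<and> t \<le> \<tau> \<and> v \<in> Q}. \<exists>p\<in>D. norm (x - p) \<le> e)"
    by blast
qed

text \<open>
  All integrands take values in one totally bounded set \<open>R\<close>: the set of all \<open>T t v\<close> with
  \<open>0 \<le> t \<le> \<tau>\<close> and \<open>v\<close> a value of \<open>K\<close>. Their integrals over \<open>[0, t]\<close> are therefore close to
  \<open>t\<close> times the convex hull of a finite net of \<open>R\<close>, which is compact.
\<close>
lemma nonlinear_part_totally_bounded:
  assumes K: "collectively_compact K" and "\<tau> > 0"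
    and sol: "\<And>x\<^sub>0. x\<^sub>0 \<in> S \<Longrightarrow> is_solution T K x\<^sub>0 (x x\<^sub>0)"
    and bdd: "bounded {x x\<^sub>0 t | t x\<^sub>0. 0 \<le> t \<and> t \<le> \<tau> \<and> x\<^sub>0 \<in> S}"
  shows "totally_bounded {x x\<^sub>0 t - T t x\<^sub>0 | t x\<^sub>0. 0 \<le> t \<and> t \<le> \<tau> \<and> x\<^sub>0 \<in> S}"
proof -
  define W where "W = {x x\<^sub>0 t | t x\<^sub>0. 0 \<le> t \<and> t \<le> \<tau> \<and> x\<^sub>0 \<in> S}"
  define Q where "Q = (\<lambda>(s, v). K s v) ` ({0..\<tau>} \<times> W)"
  define R where "R = {T t v | t v. 0 \<le> t \<and> t \<le> \<tau> \<and> v \<in> Q}"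
  have "compact (closure Q)"
    using K bdd \<open>\<tau> > 0\<close> unfolding collectively_compact_def Q_def W_def by simp
  then have "totally_bounded Q"
    using totally_bounded_subset[OF compact_imp_totally_bounded closure_subset] by blast
  then have R: "totally_bounded R"
    unfolding R_def by (rule totally_bounded_orbits)
  show ?thesis
  proof (rule totally_bounded_near)
    fix e :: real
    assume "e > 0"
    define e' where "e' = e / (2 * \<tau>)"
    have "e' > 0" using \<open>e > 0\<close> \<open>\<tau> > 0\<close> by (simp add: e'_def)
    then obtain F where F: "finite F" "\<And>v. v \<in> R \<Longrightarrow> \<exists>p\<in>F. norm (v - p) < e'"
      using R unfolding totally_bounded_norm_iff by meson
    define D where "D = insert 0 ((\<lambda>(t, h). t *\<^sub>R h) ` ({0..\<tau>} \<times> (convex hull F)))"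
    have "compact ((\<lambda>(t, h). t *\<^sub>R h) ` ({0..\<tau>} \<times> (convex hull F)))"
      using F(1) unfolding case_prod_beta
      by (intro compact_continuous_image compact_Times finite_imp_compact_convex_hull continuous_intros) auto
    then have "totally_bounded D"
      unfolding D_def by (intro compact_imp_totally_bounded compact_insert)
    moreover have "\<exists>p\<in>D. norm (x x\<^sub>0 t - T t x\<^sub>0 - p) \<le> e" if t: "0 \<le> t" "t \<le> \<tau>" "x\<^sub>0 \<in> S" for x\<^sub>0 t
    proof -
      define f where "f = (\<lambda>s. T (t - s) (K s (x x\<^sub>0 s)))"
      have f: "f integrable_on {0..t}" "x x\<^sub>0 t - T t x\<^sub>0 = integral {0..t} f"
        using sol[OF t(3)] t(1) by (auto simp: is_solution_def f_def)
      show ?thesis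
      proof (cases "t = 0")
        case True
        then show ?thesis using f(2) \<open>e > 0\<close> by (intro bexI[of _ 0]) (auto simp: D_def)
      next
        case False
        have "f s \<in> R" if s: "s \<in> {0..t}" for s
        proof -
          have "x x\<^sub>0 s \<in> W"
            unfolding W_def using s t by (intro CollectI exI[of _ s] exI[of _ x\<^sub>0]) auto
          then have "K s (x x\<^sub>0 s) \<in> Q"
            using s t by (force simp: Q_def)
          moreover have "0 \<le> t - s" "t - s \<le> \<tau>"
            using s t by auto
          ultimately show ?thesis unfolding R_def f_def by blast
        qed
        then have "\<exists>p\<in>F. norm (f s - p) \<le> e'" if "s \<in> {0..t}" for s
          using F(2)[of "f s"] that less_imp_le by blast
        then obtain h where h: "h \<in> convex hull F" "norm (integral {0..t} f - t *\<^sub>R h) \<le> 2 * e' * t"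
          using integral_near_convex_hull[OF f(1), of e' F] False t(1) \<open>e' > 0\<close> by auto
        have "2 * e' * t \<le> 2 * e' * \<tau>"
          using t(2) \<open>e' > 0\<close> by simp
        also have "\<dots> = e"
          using \<open>\<tau> > 0\<close> by (simp add: e'_def)
        finally have "norm (x x\<^sub>0 t - T t x\<^sub>0 - t *\<^sub>R h) \<le> e"
          using h(2) f(2) by simp
        moreover have "t *\<^sub>R h \<in> D"
          using h(1) t by (force simp: D_def)
        ultimately show ?thesis by blast
      qed
    qed
    ultimately show "\<exists>D. totally_bounded D \<and>
        (\<forall>v\<in>{x x\<^sub>0 t - T t x\<^sub>0 | t x\<^sub>0. 0 \<le> t \<and> t \<le> \<tau> \<and> x\<^sub>0 \<in> S}. \<exists>p\<in>D. norm (v - p) \<le> e)"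
      by blast
  qed
qed

section \<open>Directions transversal to a precompact set\<close>

text \<open>
  For a point \<open>p\<close> of a finite net of \<open>C\<close> with almost norming functional \<open>g\<close> that vanishes at \<open>m\<close>,
  \<open>\<parallel>p\<parallel> \<approx> \<bar>g p\<bar> = \<bar>g (p + m)\<bar> \<le> \<beta> \<parallel>p + m\<parallel>\<close>. So \<open>p + m\<close> is small only if \<open>p\<close> is, and then
  \<open>m = (p + m) - p\<close> is small as well; this gives the constant \<open>1 + \<beta>\<close>.
\<close>
lemma annihilator_almost_transversal:
  assumes C: "totally_bounded C" and "\<epsilon> > 0"
  obtains n :: nat and f where "\<And>j. j \<in> {1..n} \<Longrightarrow> f j \<in> adjoint_dom (generator_dom T) (generator T)"
    "\<And>v m. v \<in> C \<Longrightarrow> (\<And>j. j \<in> {1..n} \<Longrightarrow> f j m = 0) \<Longrightarrow> norm m \<le> (1 + \<beta>) * norm (v + m) + \<epsilon>"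
proof -
  define \<delta> where "\<delta> = \<epsilon> / (2 + \<beta>)"
  have \<delta>: "\<delta> > 0" "(2 + \<beta>) * \<delta> = \<epsilon>"
    using \<open>\<epsilon> > 0\<close> \<beta> by (auto simp: \<delta>_def)
  obtain F where F: "finite F" "\<And>v. v \<in> C \<Longrightarrow> \<exists>p\<in>F. norm (v - p) < \<delta>"
    using C \<delta>(1) unfolding totally_bounded_norm_iff by meson
  have "\<forall>p. \<exists>g. g \<in> adjoint_dom (generator_dom T) (generator T) \<and> norm g \<le> \<beta> \<and> cmod (g p) > norm p - \<delta>"
    using adjoint_dom_almost_norming[OF \<delta>(1)] by metis
  then obtain g where g: "\<And>p. g p \<in> adjoint_dom (generator_dom T) (generator T)"
      "\<And>p. norm (g p) \<le> \<beta>" "\<And>p. cmod (g p p) > norm p - \<delta>"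
    by metis
  obtain b where b: "bij_betw b {1..card F} F"
    using ex_bij_betw_nat_finite_1[OF F(1)] by blast
  show thesis
  proof (rule that[of "card F" "\<lambda>j. g (b j)"])
    fix v m
    assume v: "v \<in> C" and "\<And>j. j \<in> {1..card F} \<Longrightarrow> g (b j) m = 0"
    then have ker: "g p m = 0" if "p \<in> F" for p
    proof -
      have "p \<in> b ` {1..card F}"
        using b that by (simp add: bij_betw_def)
      then obtain j where "j \<in> {1..card F}" "p = b j" by blast
      then show ?thesis using \<open>\<And>j. j \<in> {1..card F} \<Longrightarrow> g (b j) m = 0\<close> by blast
    qed
    obtain p where p: "p \<in> F" "norm (v - p) < \<delta>"
      using F(2)[OF v] by blast
    have "norm p - \<delta> < cmod (g p (p + m))"
      using g(3)[of p] ker[OF p(1)] by (simp add: blinfun.add_right)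
    also have "\<dots> \<le> norm (g p) * norm (p + m)"
      by (rule norm_blinfun)
    also have "\<dots> \<le> \<beta> * norm (p + m)"
      using g(2) by (intro mult_right_mono) auto
    finally have "norm p \<le> \<beta> * norm (p + m) + \<delta>" by simp
    moreover have "norm m \<le> norm (p + m) + norm p"
      using norm_triangle_ineq4[of "p + m" p] by simp
    ultimately have "norm m \<le> (1 + \<beta>) * norm (p + m) + \<delta>"
      by (simp add: algebra_simps)
    also have "norm (p + m) \<le> norm (v + m) + \<delta>"
      using norm_triangle_ineq4[of "v + m" "v - p"] p(2) by (simp add: add.commute)
    then have "(1 + \<beta>) * norm (p + m) \<le> (1 + \<beta>) * (norm (v + m) + \<delta>)"
      using \<beta> by (intro mult_left_mono) auto
    finally show "norm m \<le> (1 + \<beta>) * norm (v + m) + \<epsilon>"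
      using \<delta>(2) by (simp add: algebra_simps)
  qed (use g(1) in auto)
qed

text \<open>
  The exponent \<open>\<mu>\<close> disappears from the statement: transversality is applied to the vectors
  \<open>c e\<^sup>\<mu>\<^sup>tu\<close>, which stay in the common kernel and have norm \<open>c e\<^sup>\<omega>\<^sup>t\<close>. One of the two losses
  \<open>c \<eta> e\<^sup>\<omega>\<^sup>t\<close> is the error in transversality, the other that of replacing \<open>e\<^sup>\<mu>\<^sup>tu\<close> by \<open>T t u\<close>.
\<close>
lemma transversal_growing_direction:
  assumes adm: "admissible T \<omega>" and V: "totally_bounded V"
    and pos: "\<tau> > 0" "c > 0" "\<eta> > 0"
  obtains u where "norm u = 1"
    "\<And>t. 0 \<le> t \<Longrightarrow> t \<le> \<tau> \<Longrightarrow> norm (T t u) \<le> (1 + \<eta>) * exp (\<omega> * t)"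
    "\<And>t v. 0 \<le> t \<Longrightarrow> t \<le> \<tau> \<Longrightarrow> v \<in> V \<Longrightarrow>
      c * (1 / (1 + \<beta>) - 2 * \<eta>) * exp (\<omega> * t) \<le> norm (T t w + v + c *\<^sub>R T t u)"
proof -
  \<comment> \<open>A lower bound of \<open>e\<^sup>\<omega>\<^sup>t\<close> on the whole interval, so that absolute errors become relative ones.\<close>
  define E where "E = exp (- (\<bar>\<omega>\<bar> * \<tau>))"
  have E: "E \<le> exp (\<omega> * t)" if "0 \<le> t" "t \<le> \<tau>" for t
  proof -
    have "- (\<omega> * t) \<le> \<bar>\<omega>\<bar> * t"
      using that by (metis abs_ge_minus_self abs_mult abs_of_nonneg)
    also have "\<dots> \<le> \<bar>\<omega>\<bar> * \<tau>"
      using that by (intro mult_left_mono) auto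
    finally show ?thesis by (simp add: E_def)
  qed
  define C where "C = {p + v | p v. p \<in> (\<lambda>t. T t w) ` {0..\<tau>} \<and> v \<in> V}"
  have "totally_bounded C"
    unfolding C_def by (intro totally_bounded_sums totally_bounded_orbit V)
  moreover have "c * \<eta> * E > 0"
    using pos by (simp add: E_def)
  ultimately obtain n f where
      f: "\<And>j. j \<in> {1..n::nat} \<Longrightarrow> f j \<in> adjoint_dom (generator_dom T) (generator T)" and
      transv: "\<And>v m. v \<in> C \<Longrightarrow> (\<And>j. j \<in> {1..n} \<Longrightarrow> f j m = 0) \<Longrightarrow>
        norm m \<le> (1 + \<beta>) * norm (v + m) + c * \<eta> * E"
    using annihilator_almost_transversal by metis
  have "\<eta> * E > 0" using pos by (simp add: E_def)
  with adm pos(1) f obtain u \<mu> where u: "u \<in> (\<Inter>j\<in>{1..n}. {x. f j x = 0})" "norm u = 1"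
      "Re \<mu> = \<omega>" "\<And>t. t \<in> {0..\<tau>} \<Longrightarrow> norm (T t u - exp (\<mu> * complex_of_real t) *\<^sub>C u) < \<eta> * E"
    unfolding admissible_def by metis
  define e where "e = (\<lambda>t. exp (\<mu> * complex_of_real t) *\<^sub>C u)"
  have norm_e: "norm (e t) = exp (\<omega> * t)" for t
    by (simp add: e_def norm_scaleC u(2,3))
  have close: "norm (T t u - e t) \<le> \<eta> * exp (\<omega> * t)" if t: "0 \<le> t" "t \<le> \<tau>" for t
  proof -
    have "norm (T t u - e t) \<le> \<eta> * E"
      using u(4)[of t] t by (simp add: e_def)
    also have "\<dots> \<le> \<eta> * exp (\<omega> * t)"
      using E[OF t] pos(3) by simp
    finally show ?thesis .
  qed
  show thesis
  proof (rule that)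
    show "norm u = 1" by (rule u(2))
    fix t
    assume t: "0 \<le> t" "t \<le> \<tau>"
    show "norm (T t u) \<le> (1 + \<eta>) * exp (\<omega> * t)"
      using norm_triangle_sub[of "T t u" "e t"] close[OF t] norm_e[of t] by (simp add: algebra_simps)
    fix v
    assume v: "v \<in> V"
    define N where "N = norm (T t w + v + c *\<^sub>R e t)"
    have "f j (c *\<^sub>R e t) = 0" if "j \<in> {1..n}" for j
      using u(1) f[OF that] that
      by (auto simp: e_def blinfun.scaleR_right adjoint_dom_def dual_space_def clinear_blinfun_def scaleC_complex_def)
    moreover have "T t w + v \<in> C"
      unfolding C_def using t v by force
    ultimately have "norm (c *\<^sub>R e t) \<le> (1 + \<beta>) * N + c * \<eta> * E"
      unfolding N_def by (intro transv)
    moreover have "c * \<eta> * E \<le> c * \<eta> * exp (\<omega> * t)"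
      using E[OF t] pos by simp
    ultimately have "c * exp (\<omega> * t) - c * \<eta> * exp (\<omega> * t) \<le> (1 + \<beta>) * N"
      using pos(2) norm_scaleR[of c "e t"] by (simp only: norm_e abs_of_pos)
    then have "(c * exp (\<omega> * t) - c * \<eta> * exp (\<omega> * t)) / (1 + \<beta>) \<le> N"
      using \<beta> by (simp add: pos_divide_le_eq mult.commute)
    moreover have "c * \<eta> * exp (\<omega> * t) / (1 + \<beta>) \<le> c * \<eta> * exp (\<omega> * t)"
      using \<beta> pos by (auto simp: divide_le_eq mult_le_cancel_left1 not_less)
    ultimately have "c * exp (\<omega> * t) / (1 + \<beta>) - c * \<eta> * exp (\<omega> * t) \<le> N"
      by (simp add: diff_divide_distrib)
    moreover have "N \<le> norm (T t w + v + c *\<^sub>R T t u) + c * (\<eta> * exp (\<omega> * t))"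
    proof -
      have "norm (c *\<^sub>R (T t u - e t)) \<le> c * (\<eta> * exp (\<omega> * t))"
        using close[OF t] pos(2) by simp
      then show ?thesis
        using norm_triangle_ineq4[of "T t w + v + c *\<^sub>R T t u" "c *\<^sub>R (T t u - e t)"]
        by (simp add: N_def scaleR_diff_right)
    qed
    ultimately show "c * (1 / (1 + \<beta>) - 2 * \<eta>) * exp (\<omega> * t) \<le> norm (T t w + v + c *\<^sub>R T t u)"
      by (simp add: algebra_simps)
  qed
qed

end

section \<open>Construction of the initial value\<close>

text \<open>
  The constant \<open>\<kappa>\<close> is the lower bound that the construction yields, divided by \<open>r q\<^sup>k e\<^sup>\<omega>\<^sup>t\<close>: in
  the bracket the direction \<open>u\<^sub>k\<close> contributes the first two terms, and the last is the size of
  \<open>c\<^sub>k\<^sub>+\<^sub>1 + c\<^sub>k\<^sub>+\<^sub>2 + \<dots> = c\<^sub>k q / (1 - q)\<close>, amplified by the bound \<open>(1 + q) e\<^sup>\<omega>\<^sup>t\<close> for the orbits.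
\<close>
lemma large_solution_exists:
  fixes T :: "real \<Rightarrow> 'a::complex_banach \<Rightarrow>\<^sub>L 'a" and \<beta> q \<kappa> :: real
  assumes T: "C0_semigroup T"
    and near_0: "\<forall>\<^sub>F t in at_right 0. norm (T t) < \<beta>" and \<beta>: "\<beta> \<ge> 1"
    and K: "collectively_compact K"
    and sol: "\<And>x\<^sub>0. x\<^sub>0 \<in> cball y r \<Longrightarrow> is_solution T K x\<^sub>0 (x x\<^sub>0)"
    and bdd: "\<And>\<tau>. \<tau> > 0 \<Longrightarrow> bounded {x x\<^sub>0 t | t x\<^sub>0. 0 \<le> t \<and> t \<le> \<tau> \<and> x\<^sub>0 \<in> cball y r}"
    and a: "\<And>t. t \<ge> 0 \<Longrightarrow> a t \<ge> 0" "antimono_on {0..} a" "(a \<longlongrightarrow> 0) at_top"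
    and t\<^sub>0: "t\<^sub>0 \<ge> 0"
    and adm: "admissible T \<omega>"
    and r: "r > 0" and q: "0 < q" "q < 1"
    and \<kappa>: "\<kappa> = (1 - q) * (1 / (1 + \<beta>) - 2 * q - (1 + q) * (q / (1 - q)))" "a t\<^sub>0 < r * \<kappa>"
  shows "\<exists>z\<in>cball y r. \<forall>t\<ge>t\<^sub>0. norm (x z t) \<ge> a t * exp (\<omega> * t)"
proof -
  have rk: "r * \<kappa> > 0"
    using a(1)[OF t\<^sub>0] \<kappa>(2) by linarith
  \<comment> \<open>The condition \<open>k \<le> s k\<close> makes the times exhaust \<open>[t\<^sub>0, \<infinity>)\<close>. For \<open>k = 0\<close> the bound on \<open>a\<close> is the
    hypothesis on \<open>a t\<^sub>0\<close>, for the others it holds at all late times.\<close>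
  have "\<exists>s. (k = 0 \<longrightarrow> s = t\<^sub>0) \<and> real k \<le> s \<and> (\<forall>t\<ge>s. a t \<le> r * \<kappa> * q ^ k)" for k
  proof (cases "k = 0")
    case True
    then show ?thesis
      using a(2) t\<^sub>0 \<kappa>(2) by (intro exI[of _ t\<^sub>0]) (force simp: monotone_on_def)
  next
    case False
    have "r * \<kappa> * q ^ k > 0"
      using rk q(1) by simp
    then have "\<forall>\<^sub>F t in at_top. a t < r * \<kappa> * q ^ k"
      by (rule order_tendstoD(2)[OF a(3)])
    then obtain N where N: "\<And>t. t \<ge> N \<Longrightarrow> a t < r * \<kappa> * q ^ k"
      by (auto simp: eventually_at_top_linorder)
    then have "\<forall>t\<ge>max N (real k). a t \<le> r * \<kappa> * q ^ k"
      by (auto intro: less_imp_le)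
    then show ?thesis
      using False by (intro exI[of _ "max N (real k)"]) simp
  qed
  then have "\<exists>s. \<forall>k. (k = 0 \<longrightarrow> s k = t\<^sub>0) \<and> real k \<le> s k \<and> (\<forall>t\<ge>s k. a t \<le> r * \<kappa> * q ^ k)"
    by (intro choice allI)
  then obtain s where s: "s 0 = t\<^sub>0" "\<And>k. real k \<le> s k"
      "\<And>k t. s k \<le> t \<Longrightarrow> a t \<le> r * \<kappa> * q ^ k"
    by blast
  define c where "c = (\<lambda>k. r * (1 - q) * q ^ k)"
  define V where "V = (\<lambda>\<tau>. {x x\<^sub>0 t - T t x\<^sub>0 | t x\<^sub>0. 0 \<le> t \<and> t \<le> \<tau> \<and> x\<^sub>0 \<in> cball y r})"
  have c_pos: "c k > 0" for k
    using r q by (simp add: c_def)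
  have s_pos: "s (Suc k) > 0" for k
    using s(2)[of "Suc k"] by simp
  have V: "totally_bounded (V (s (Suc k)))" for k
    unfolding V_def by (intro nonlinear_part_totally_bounded[OF T near_0 \<beta> K] s_pos sol bdd)
  define good where "good = (\<lambda>k w u. norm u = 1 \<and> (\<forall>t. 0 \<le> t \<longrightarrow> t \<le> s (Suc k) \<longrightarrow>
      norm (T t u) \<le> (1 + q) * exp (\<omega> * t) \<and>
      (\<forall>v\<in>V (s (Suc k)). c k * (1 / (1 + \<beta>) - 2 * q) * exp (\<omega> * t) \<le> norm (T t w + v + c k *\<^sub>R T t u))))"
  have "\<exists>u. good k w u" for k w
  proof -
    obtain u where "norm u = 1"
      "\<And>t. 0 \<le> t \<Longrightarrow> t \<le> s (Suc k) \<Longrightarrow> norm (T t u) \<le> (1 + q) * exp (\<omega> * t)"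
      "\<And>t v. 0 \<le> t \<Longrightarrow> t \<le> s (Suc k) \<Longrightarrow> v \<in> V (s (Suc k)) \<Longrightarrow>
        c k * (1 / (1 + \<beta>) - 2 * q) * exp (\<omega> * t) \<le> norm (T t w + v + c k *\<^sub>R T t u)"
      using transversal_growing_direction[OF T near_0 \<beta> adm V[of k] s_pos[of k] c_pos[of k] q(1), where w = w] by blast
    then show ?thesis unfolding good_def by blast
  qed
  then obtain U where "\<And>k w. good k w (U k w)"
    by metis
  then have U: "norm (U k w) = 1"
      "0 \<le> t \<Longrightarrow> t \<le> s (Suc k) \<Longrightarrow> norm (T t (U k w)) \<le> (1 + q) * exp (\<omega> * t)"
      "0 \<le> t \<Longrightarrow> t \<le> s (Suc k) \<Longrightarrow> v \<in> V (s (Suc k)) \<Longrightarrow>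
        c k * (1 / (1 + \<beta>) - 2 * q) * exp (\<omega> * t) \<le> norm (T t w + v + c k *\<^sub>R T t (U k w))" for k w t v
    unfolding good_def by blast+
  \<comment> \<open>\<open>Z k\<close> is the partial sum from which the direction \<open>u k\<close> is chosen.\<close>
  define Z where "Z = rec_nat y (\<lambda>k w. w + c k *\<^sub>R U k w)"
  define u where "u = (\<lambda>k. U k (Z k))"
  have Z: "Z k = y + (\<Sum>j<k. c j *\<^sub>R u j)" for k
    by (induction k) (auto simp: Z_def u_def)
  have c_sums: "(\<lambda>j. c (j + k)) sums (r * q ^ k)" for k
  proof -
    have "(\<lambda>j. r * (1 - q) * q ^ k * q ^ j) sums (r * (1 - q) * q ^ k * (1 / (1 - q)))"
      using q by (intro sums_mult geometric_sums) auto
    then show ?thesis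
      using q by (simp add: c_def power_add mult_ac)
  qed
  have norm_cu: "norm (c j *\<^sub>R u j) = c j" for j
    using U(1) c_pos[of j] by (simp add: u_def)
  have c_sum: "c sums r"
    using c_sums[of 0] by simp
  have summ: "summable (\<lambda>j. c j *\<^sub>R u j)"
    by (rule summable_norm_cancel) (simp only: norm_cu sums_summable[OF c_sum])
  define z where "z = y + (\<Sum>j. c j *\<^sub>R u j)"
  have "norm (\<Sum>j. c j *\<^sub>R u j) \<le> (\<Sum>j. norm (c j *\<^sub>R u j))"
    by (rule summable_norm) (simp only: norm_cu sums_summable[OF c_sum])
  also have "\<dots> = r"
    by (simp only: norm_cu sums_unique[OF c_sum])
  finally have z: "z \<in> cball y r"
    by (simp add: z_def dist_norm)
  have "norm (x z t) \<ge> a t * exp (\<omega> * t)" if t: "t \<ge> t\<^sub>0" for t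
  proof -
    \<comment> \<open>The times \<open>s k\<close> need not increase. With the last \<open>k\<close> such that \<open>s k \<le> t\<close>, every later
      direction is controlled at time \<open>t\<close>.\<close>
    have "finite {k. s k \<le> t}"
    proof (rule finite_subset)
      show "{k. s k \<le> t} \<subseteq> {..nat \<lceil>t\<rceil>}"
      proof
        fix k
        assume "k \<in> {k. s k \<le> t}"
        then have "real k \<le> t" using s(2)[of k] by simp
        also have "t \<le> real (nat \<lceil>t\<rceil>)" by (rule real_nat_ceiling_ge)
        finally show "k \<in> {..nat \<lceil>t\<rceil>}" by simp
      qed
    qed simp
    moreover have "0 \<in> {k. s k \<le> t}"
      using s(1) t by simp
    ultimately obtain k where k: "s k \<le> t" "\<And>j. s j \<le> t \<Longrightarrow> j \<le> k"
      using Max_in[of "{k. s k \<le> t}"] Max_ge[of "{k. s k \<le> t}"] by blast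
    have t_le: "t \<le> s (Suc j)" if "j \<ge> k" for j
      using k(2)[of "Suc j"] that by linarith
    have "t \<ge> 0" using t t\<^sub>0 by simp
    define tail where "tail = (\<Sum>j. c (j + Suc k) *\<^sub>R T t (u (j + Suc k)))"
    have summ': "summable (\<lambda>j. c (j + Suc k) *\<^sub>R u (j + Suc k))"
      using summ by (rule summable_ignore_initial_segment)
    have "z = Z (Suc k) + (\<Sum>j. c (j + Suc k) *\<^sub>R u (j + Suc k))"
      unfolding z_def Z using suminf_split_initial_segment[OF summ, of "Suc k"] by (simp add: algebra_simps)
    then have "T t z = T t (Z k) + c k *\<^sub>R T t (u k) + T t (\<Sum>j. c (j + Suc k) *\<^sub>R u (j + Suc k))"
      by (simp add: Z blinfun.add_right blinfun.scaleR_right)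
    also have "T t (\<Sum>j. c (j + Suc k) *\<^sub>R u (j + Suc k)) = tail"
      using bounded_linear.suminf[OF blinfun.bounded_linear_right summ', of "T t"]
      by (simp add: tail_def blinfun.scaleR_right)
    finally have Tz: "T t z = T t (Z k) + c k *\<^sub>R T t (u k) + tail" .
    have tail: "norm tail \<le> r * q ^ Suc k * ((1 + q) * exp (\<omega> * t))"
    proof -
      have lim: "(\<lambda>j. c (j + Suc k) * ((1 + q) * exp (\<omega> * t))) sums (r * q ^ Suc k * ((1 + q) * exp (\<omega> * t)))"
        by (intro sums_mult2 c_sums)
      have "norm (c (j + Suc k) *\<^sub>R T t (u (j + Suc k))) \<le> c (j + Suc k) * ((1 + q) * exp (\<omega> * t))" for j
        using U(2)[OF \<open>t \<ge> 0\<close> t_le[of "j + Suc k"]] c_pos[of "j + Suc k"] by (simp add: u_def)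
      then have "norm tail \<le> (\<Sum>j. c (j + Suc k) * ((1 + q) * exp (\<omega> * t)))"
        unfolding tail_def by (rule norm_suminf_le[OF _ sums_summable[OF lim]])
      then show ?thesis
        by (simp only: sums_unique[OF lim])
    qed
    \<comment> \<open>The direction \<open>u k\<close> was chosen before \<open>z\<close> was known, but transversally to the nonlinear
      parts of all solutions that start in the ball.\<close>
    have "x z t - T t z \<in> V (s (Suc k))"
      unfolding V_def using z \<open>t \<ge> 0\<close> t_le[of k] by (intro CollectI exI[of _ t] exI[of _ z]) auto
    then have "c k * (1 / (1 + \<beta>) - 2 * q) * exp (\<omega> * t)
        \<le> norm (T t (Z k) + (x z t - T t z) + c k *\<^sub>R T t (u k))"
      unfolding u_def using \<open>t \<ge> 0\<close> t_le[of k] by (intro U(3)) auto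
    also have "T t (Z k) + (x z t - T t z) + c k *\<^sub>R T t (u k) = x z t - tail"
      by (simp add: Tz algebra_simps)
    also have "norm \<dots> \<le> norm (x z t) + r * q ^ Suc k * ((1 + q) * exp (\<omega> * t))"
      using norm_triangle_ineq4[of "x z t" tail] tail by linarith
    finally have "(c k * (1 / (1 + \<beta>) - 2 * q) - r * q ^ Suc k * (1 + q)) * exp (\<omega> * t) \<le> norm (x z t)"
      by (simp add: algebra_simps)
    also have "c k * (1 / (1 + \<beta>) - 2 * q) - r * q ^ Suc k * (1 + q) = r * \<kappa> * q ^ k"
    proof -
      have "(1 - q) * ((1 + q) * (q / (1 - q))) = (1 + q) * ((1 - q) * (q / (1 - q)))"
        by (rule mult.left_commute)
      also have "(1 - q) * (q / (1 - q)) = q"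
        using q(2) by simp
      finally have \<kappa>_eq: "\<kappa> = (1 - q) * (1 / (1 + \<beta>) - 2 * q) - (1 + q) * q"
        unfolding \<kappa>(1) by (simp only: right_diff_distrib[of "1 - q" _ "(1 + q) * (q / (1 - q))"])
      have "r * (1 - q) * p * B - r * (q * p) * (1 + q) = r * ((1 - q) * B - (1 + q) * q) * p" for p B :: real
        by (simp add: algebra_simps)
      then show ?thesis unfolding \<kappa>_eq c_def power_Suc .
    qed
    finally have "r * \<kappa> * q ^ k * exp (\<omega> * t) \<le> norm (x z t)" .
    moreover have "a t * exp (\<omega> * t) \<le> r * \<kappa> * q ^ k * exp (\<omega> * t)"
      using s(3)[OF k(1)] by (intro mult_right_mono) auto
    ultimately show ?thesis by linarith
  qed
  with z show ?thesis by blast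
qed

text \<open>
  Strong continuity keeps \<open>T t e\<close> close to \<open>e\<close>; a unit vector exists as soon as some number is
  admissible.
\<close>
lemma growth_at_0_ge_1:
  fixes T :: "real \<Rightarrow> 'a::complex_banach \<Rightarrow>\<^sub>L 'a" and e :: 'a
  assumes T: "C0_semigroup T" and e: "norm e = 1"
  shows "1 \<le> Limsup (at_right 0) (\<lambda>t. ereal (norm (T t)))"
proof -
  have "((\<lambda>t. T t e) \<longlongrightarrow> e) (at_right 0)"
    using T by (simp add: C0_semigroup_def)
  then have "((\<lambda>t. ereal (norm (T t e))) \<longlongrightarrow> ereal (norm e)) (at_right 0)"
    by (intro tendsto_intros)
  then have "Limsup (at_right 0) (\<lambda>t. ereal (norm (T t e))) = 1"
    using e by (subst lim_imp_Limsup) (auto simp: one_ereal_def)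
  moreover have "Limsup (at_right 0) (\<lambda>t. ereal (norm (T t e))) \<le> Limsup (at_right 0) (\<lambda>t. ereal (norm (T t)))"
    using norm_blinfun[of "T _" e] e by (intro Limsup_mono always_eventually) simp
  ultimately show ?thesis by simp
qed

theorem theorem7p6:
  fixes T :: "real \<Rightarrow> 'a::complex_banach \<Rightarrow>\<^sub>L 'a"
    and K :: "real \<Rightarrow> 'a \<Rightarrow> 'a"
    and X\<^sub>0 :: "'a set" and y :: 'a and r :: real
    and a :: "real \<Rightarrow> real" and t\<^sub>0 \<omega> :: real and \<alpha> :: ereal
  assumes "infinite_dimensional TYPE('a)"
    and "C0_semigroup T"
    and "collectively_compact K" and "separately_continuous K"
    and "r > 0" and "cball y r \<subseteq> X\<^sub>0"
    and "\<exists>x :: 'a \<Rightarrow> real \<Rightarrow> 'a.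
           (\<forall>x\<^sub>0\<in>cball y r. is_solution T K x\<^sub>0 (x x\<^sub>0)) \<and>
           (\<forall>\<tau>>0. bounded {x x\<^sub>0 t | t x\<^sub>0. 0 \<le> t \<and> t \<le> \<tau> \<and> x\<^sub>0 \<in> cball y r})"
    and "\<alpha> = Limsup (at_right 0) (\<lambda>t. ereal (norm (T t)))"
    and "\<forall>t\<ge>0. a t \<ge> 0" and "antimono_on {0..} a" and "(a \<longlongrightarrow> 0) at_top"
    and "t\<^sub>0 \<ge> 0" and "ereal (a t\<^sub>0) < ereal r / (2 * \<alpha>)"
    and "admissible T \<omega>"
  shows "\<exists>z\<in>cball y r. \<exists>u. is_solution T K z u \<and> (\<forall>t\<ge>t\<^sub>0. norm (u t) \<ge> a t * exp (\<omega> * t))"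
proof -
  obtain x where x_all: "(\<forall>x\<^sub>0\<in>cball y r. is_solution T K x\<^sub>0 (x x\<^sub>0)) \<and>
      (\<forall>\<tau>>0. bounded {x x\<^sub>0 t | t x\<^sub>0. 0 \<le> t \<and> t \<le> \<tau> \<and> x\<^sub>0 \<in> cball y r})"
    using assms(7) by (rule exE)
  note sol = x_all[THEN conjunct1, rule_format] and bdd = x_all[THEN conjunct2, rule_format]
  have "\<exists>n::nat. \<exists>f :: nat \<Rightarrow> 'a \<Rightarrow>\<^sub>L complex.
      (\<forall>j\<in>{1..n}. f j \<in> adjoint_dom (generator_dom T) (generator T)) \<and>
      UNIV = (\<Inter>j\<in>{1..n}. {x. f j x = 0})"
    by (rule exI[of _ 0], rule exI[of _ "\<lambda>_. 0"]) simp
  \<comment> \<open>Admissibility for the empty family of functionals provides a unit vector.\<close>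
  with assms(14)[unfolded admissible_def, rule_format, of 1 1 UNIV]
  obtain e :: 'a where e: "norm e = 1"
    by auto
  \<comment> \<open>In the extended reals \<open>r / \<infinity> = 0\<close>, which is not above \<open>a t\<^sub>0\<close>.\<close>
  have "\<alpha> \<noteq> \<infinity>"
  proof
    assume "\<alpha> = \<infinity>"
    then have "ereal (a t\<^sub>0) < 0"
      using assms(13) by simp
    then show False using assms(9)[rule_format, OF assms(12)] by simp
  qed
  moreover have "1 \<le> \<alpha>"
    unfolding assms(8) using assms(2) e by (rule growth_at_0_ge_1)
  ultimately obtain A where A: "\<alpha> = ereal A" "A \<ge> 1"
    by (cases \<alpha>) auto
  have a_less: "a t\<^sub>0 < r / (1 + A)"
  proof -
    have "a t\<^sub>0 < r / (2 * A)"
      using assms(13) A by simp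
    also have "\<dots> \<le> r / (1 + A)"
      using A(2) assms(5) by (intro divide_left_mono) auto
    finally show ?thesis .
  qed
  \<comment> \<open>One parameter suffices: \<open>\<beta> = A + q\<close>.\<close>
  define \<kappa> where "\<kappa> = (\<lambda>q. (1 - q) * (1 / (1 + (A + q)) - 2 * q - (1 + q) * (q / (1 - q))))"
  have "((\<lambda>q. r * \<kappa> q) \<longlongrightarrow> r / (1 + A)) (at_right 0)"
    unfolding \<kappa>_def using A(2) by (auto intro!: tendsto_eq_intros)
  then have "\<forall>\<^sub>F q in at_right 0. a t\<^sub>0 < r * \<kappa> q"
    using a_less by (rule order_tendstoD(1))
  moreover have "\<forall>\<^sub>F q in at_right 0. q < (1::real)"
    by (rule eventually_at_right_real[of 0 1, THEN eventually_mono]) auto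
  moreover have "\<forall>\<^sub>F q in at_right 0. (0::real) < q"
    by (rule eventually_at_right_less)
  ultimately have "\<forall>\<^sub>F q in at_right 0. a t\<^sub>0 < r * \<kappa> q \<and> q < 1 \<and> 0 < q"
    by eventually_elim simp
  then obtain q where q: "a t\<^sub>0 < r * \<kappa> q" "q < 1" "0 < q"
    using eventually_happens' trivial_limit_at_right_real by blast
  have "Limsup (at_right 0) (\<lambda>t. ereal (norm (T t))) < ereal (A + q)"
    using A(1) q(3) assms(8) by simp
  then have near_0: "\<forall>\<^sub>F t in at_right 0. norm (T t) < A + q"
    by (auto dest: Limsup_lessD)
  have "\<exists>z\<in>cball y r. \<forall>t\<ge>t\<^sub>0. norm (x z t) \<ge> a t * exp (\<omega> * t)"
    using assms(2) near_0 _ assms(3) sol bdd _ assms(10,11,12,14,5) q(3,2) _ q(1)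
  proof (rule large_solution_exists)
    show "A + q \<ge> 1" using A(2) q(3) by simp
    show "a t \<ge> 0" if "t \<ge> 0" for t using assms(9) that by simp
    show "\<kappa> q = (1 - q) * (1 / (1 + (A + q)) - 2 * q - (1 + q) * (q / (1 - q)))"
      by (simp add: \<kappa>_def)
  qed
  then show ?thesis using sol by blast
qed

end
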